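(* Let $(\mathcal X,\rho)$ be a Polish space, $\mu\in P_2(\mathcal X)$ and $a>0$. The following are equivalent: (1) There exist $r_o,b\ge0$ such that for all $n\ge1$, all measurable $A\subset\mathcal X^n$ with $\mu^n(A)\ge1/2$ and all $r\ge r_o$, $\mu^n(A^r)\ge 1-b\,e^{-a(r-r_o)^2}$. (2) $\mu$ satisfies $\mathbf T_2(1/a)$: $\mathcal T_2(\nu,\mu)\le\frac1a H(\nu\,|\,\mu)$ for all Borel probability measures $\nu$ on $\mathcal X$.
   Context: $P_2(\mathcal X)$: probability measures with finite second moment $\int\rho(x_o,x)^2d\nu<\infty$. $\mathcal T_2(\nu,\mu)=\inf_\pi\int\rho(x,y)^2d\pi(x,y)$ over couplings $\pi$ of $\nu,\mu$. $H(\nu\,|\,\mu)=\int\log\frac{d\nu}{d\mu}d\nu$ if $\nu\ll\mu$, $+\infty$ otherwise. On $\mathcal X^n$ use the metric $\rho_2^n(x,y)=\big(\sum_{i=1}^n\rho(x^i,y^i)^2\big)^{1/2}$ for $x=(x^1,\dots,x^n)$, and $A^r=\{x\in\mathcal X^n:\exists\bar x\in A,\ \rho_2^n(x,\bar x)\le r\}$. *)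

theory Defs
  imports "HOL-Probability.Probability"
begin

definition P2 :: "'a::metric_space measure \<Rightarrow> bool" where
  "P2 \<mu> \<longleftrightarrow> prob_space \<mu> \<and> sets \<mu> = sets borel \<and>
     (\<exists>x\<^sub>o. (\<integral>\<^sup>+ x. ennreal ((dist x\<^sub>o x)\<^sup>2) \<partial>\<mu>) < \<infinity>)"

definition couplings :: "'a::metric_space measure \<Rightarrow> 'a measure \<Rightarrow> ('a \<times> 'a) measure set" where
  "couplings \<nu> \<mu> = {\<pi>. prob_space \<pi> \<and> sets \<pi> = sets (borel \<Otimes>\<^sub>M borel) \<and>
      distr \<pi> borel fst = \<nu> \<and> distr \<pi> borel snd = \<mu>}"

definition transport_cost2 :: "'a::metric_space measure \<Rightarrow> 'a measure \<Rightarrow> ennreal" where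
  "transport_cost2 \<nu> \<mu> =
     (INF \<pi> \<in> couplings \<nu> \<mu>. \<integral>\<^sup>+ p. ennreal ((dist (fst p) (snd p))\<^sup>2) \<partial>\<pi>)"

text \<open>Relative entropy H(\<nu>|\<mu>) = \<integral> log (d\<nu>/d\<mu>) d\<nu> if \<nu> \<ll> \<mu>, +\<infinity> otherwise.
  For probability measures the negative part of the integrand is always \<nu>-integrable,
  so a non-integrable log-density means the integral is +\<infinity>.\<close>
definition rel_entropy :: "'a measure \<Rightarrow> 'a measure \<Rightarrow> ereal" where
  "rel_entropy \<nu> \<mu> =
     (if absolutely_continuous \<mu> \<nu> then
        (if integrable \<nu> (\<lambda>x. ln (enn2real (RN_deriv \<mu> \<nu> x)))
         then ereal (\<integral> x. ln (enn2real (RN_deriv \<mu> \<nu> x)) \<partial>\<nu>)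
         else \<infinity>)
      else \<infinity>)"

definition prod_pow :: "'a measure \<Rightarrow> nat \<Rightarrow> (nat \<Rightarrow> 'a) measure" where
  "prod_pow \<mu> n = PiM {..<n} (\<lambda>_. \<mu>)"

definition rho2 :: "nat \<Rightarrow> (nat \<Rightarrow> 'a::metric_space) \<Rightarrow> (nat \<Rightarrow> 'a) \<Rightarrow> real" where
  "rho2 n x y = sqrt (\<Sum>i<n. (dist (x i) (y i))\<^sup>2)"

definition enlarge :: "'a::metric_space measure \<Rightarrow> nat \<Rightarrow> (nat \<Rightarrow> 'a) set \<Rightarrow> real \<Rightarrow> (nat \<Rightarrow> 'a) set" where
  "enlarge \<mu> n A r = {x \<in> space (prod_pow \<mu> n). \<exists>xb \<in> A. rho2 n x xb \<le> r}"

text \<open>Outer measure (A^r need not be Borel, only universally measurable; the outer measure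
  agrees with its completion measure).\<close>
definition outer_measure :: "'a measure \<Rightarrow> 'a set \<Rightarrow> real" where
  "outer_measure M S = Inf {measure M B | B. B \<in> sets M \<and> S \<subseteq> B}"

end

(* (2) ==> (1).  If G x <= phi y + d(x,y)^2, testing T_2 on the tilted measure nu proportional to
   exp (a G) mu gives int exp (a G) dmu <= exp (a int phi dmu).  This functional inequality passes to
   product spaces by integrating out one coordinate at a time; applied to multiples of a 1-Lipschitz F
   it yields Gaussian deviations of F above its mean.  For F the truncated distance to A, the
   deviation of -F bounds the mean by sqrt (ln 2 / a), that of F bounds the measure of {F >= r}.

   (1) ==> (2).  Let H be the entropy of nu.  Samples whose empirical measure is close to mu
   have mu^n-probability at least 1/2, and those whose empirical measure is close to nu have
   probability about exp (- n H).  Concentration forces the enlargement of the first set at radius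
   about sqrt (n H / a) to meet the second one, which gives an empirical coupling of cost about H / a.
   Taking limits of the joint masses on the cells of a fixed finite partition and choosing
   the points independently within the cells turns it into a coupling of nu and mu. *)
theory Submission
  imports Defs
begin

section \<open>From the transport inequality to concentration\<close>

text \<open>From (2) to (1) only the easy half of Kantorovich duality enters, and what passes to
  products is a functional inequality: gluing conditional couplings would call for measurable
  selections, whereas integrating out a coordinate is Fubini. From (1) to (2) the constants
  \<open>r\<^sub>o\<close> and \<open>b\<close> must leave no trace in the sharp constant 1/a. They
  vanish because the relevant squared radii are of order n: for the radius \<open>r\<^sub>o\<close>
  + sqrt (n c) the squared radius divided by n tends to c, and \<open>b\<close> loses against a
  factor exp (- n e'). Hence the need for all n at once. Closeness of empirical measures is tested
  by finitely many integrable functions, chosen for each use: ln h for the entropy, indicators of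
  cells for the marginals, the squared discretization error for the cost. The obstacle is that the
  squared distance must be integrable for \<nu>, of which only finite entropy is known; a
  preliminary use of concentration with truncated squared distances supplies that moment.\<close>

lemma rel_entropy_density:
  fixes g :: "'a \<Rightarrow> real"
  assumes "prob_space \<mu>" and g: "g \<in> borel_measurable \<mu>"
    and pos: "\<And>x. 0 < g x"
    and int: "integrable (density \<mu> g) (\<lambda>x. ln (g x))"
  shows "rel_entropy (density \<mu> g) \<mu> = ereal (\<integral>x. ln (g x) \<partial>density \<mu> g)"
proof -
  interpret prob_space \<mu> by fact
  have [measurable]: "g \<in> borel_measurable \<mu>" by fact
  define \<nu> where "\<nu> = density \<mu> g"
  have ac: "absolutely_continuous \<mu> \<nu>"
    unfolding \<nu>_def by (rule absolutely_continuousI_density) simp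
  have "AE x in \<mu>. ennreal (g x) = RN_deriv \<mu> \<nu> x"
    by (rule RN_deriv_unique) (auto simp: \<nu>_def)
  then have "AE x in \<nu>. ennreal (g x) = RN_deriv \<mu> \<nu> x"
    unfolding \<nu>_def by (subst AE_density) auto
  then have AE: "AE x in \<nu>. ln (enn2real (RN_deriv \<mu> \<nu> x)) = ln (g x)"
  proof eventually_elim
    case (elim x)
    then show ?case using pos[of x] by (metis enn2real_ennreal less_imp_le)
  qed
  have m: "(\<lambda>x. ln (enn2real (RN_deriv \<mu> \<nu> x))) \<in> borel_measurable \<nu>"
    "(\<lambda>x. ln (g x)) \<in> borel_measurable \<nu>" by (auto simp: \<nu>_def)
  have "integrable \<nu> (\<lambda>x. ln (enn2real (RN_deriv \<mu> \<nu> x)))"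
    using integrable_cong_AE[OF m AE] int by (simp add: \<nu>_def)
  moreover have "(\<integral>x. ln (enn2real (RN_deriv \<mu> \<nu> x)) \<partial>\<nu>) = (\<integral>x. ln (g x) \<partial>\<nu>)"
    by (rule integral_cong_AE[OF m AE])
  ultimately show ?thesis using ac unfolding rel_entropy_def \<nu>_def by auto
qed

text \<open>Since \<open>ennreal\<close> cuts negative values to 0, the right side is the integral
  of the positive part of f.\<close>

lemma ennreal_integral_le_nn_integral:
  fixes f :: "'a \<Rightarrow> real"
  assumes "integrable M f"
  shows "ennreal (\<integral>x. f x \<partial>M) \<le> (\<integral>\<^sup>+ x. ennreal (f x) \<partial>M)"
proof -
  have "ennreal (\<integral>x. f x \<partial>M) \<le> ennreal (\<integral>x. max 0 (f x) \<partial>M)"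
    by (intro ennreal_leI integral_mono) (use assms in auto)
  also have "\<dots> = (\<integral>\<^sup>+ x. ennreal (max 0 (f x)) \<partial>M)"
    by (intro nn_integral_eq_integral[symmetric]) (use assms in auto)
  also have "\<dots> = (\<integral>\<^sup>+ x. ennreal (f x) \<partial>M)"
    by (intro nn_integral_cong) (auto simp: max_def ennreal_neg)
  finally show ?thesis .
qed

lemma integrable_bounded_prob:
  fixes f :: "'a \<Rightarrow> real"
  assumes "prob_space M" and "f \<in> borel_measurable M" and "\<And>x. \<bar>f x\<bar> \<le> B"
  shows "integrable M f"
proof -
  interpret prob_space M by fact
  show ?thesis by (rule integrable_const_bound[of _ B]) (use assms in auto)
qed

text \<open>The easy half of Kantorovich duality: integrate the pointwise bound against an arbitrary
  coupling. Boundedness makes both integrals finite, so that they may be subtracted.\<close>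

lemma transport_cost2_ge_dual:
  fixes \<nu> \<mu> :: "'a::metric_space measure" and G \<phi> :: "'a \<Rightarrow> real"
  assumes G: "G \<in> borel_measurable borel" "\<And>x. \<bar>G x\<bar> \<le> B"
    and \<phi>: "\<phi> \<in> borel_measurable borel" "\<And>x. \<bar>\<phi> x\<bar> \<le> B"
    and le: "\<And>x y. G x \<le> \<phi> y + (dist x y)\<^sup>2"
  shows "ennreal ((\<integral>x. G x \<partial>\<nu>) - (\<integral>y. \<phi> y \<partial>\<mu>)) \<le> transport_cost2 \<nu> \<mu>"
  unfolding transport_cost2_def
proof (rule INF_greatest)
  fix \<pi> assume "\<pi> \<in> couplings \<nu> \<mu>"
  then have \<pi>: "prob_space \<pi>" and sets: "sets \<pi> = sets (borel \<Otimes>\<^sub>M borel)"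
    and d: "distr \<pi> borel fst = \<nu>" "distr \<pi> borel snd = \<mu>"
    by (auto simp: couplings_def)
  have m: "fst \<in> measurable \<pi> borel" "snd \<in> measurable \<pi> borel"
    using measurable_fst measurable_snd measurable_cong_sets[OF sets refl] by blast+
  have i: "integrable \<pi> (\<lambda>p. G (fst p))" "integrable \<pi> (\<lambda>p. \<phi> (snd p))"
    by (auto intro!: integrable_bounded_prob[OF \<pi>, of _ B] G \<phi>
        intro: measurable_compose[OF m(1)] measurable_compose[OF m(2)])
  have "(\<integral>x. G x \<partial>\<nu>) - (\<integral>y. \<phi> y \<partial>\<mu>) = (\<integral>p. G (fst p) \<partial>\<pi>) - (\<integral>p. \<phi> (snd p) \<partial>\<pi>)"
    unfolding d[symmetric] by (simp add: integral_distr[OF m(1)] integral_distr[OF m(2)] G \<phi>)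
  also have "\<dots> = (\<integral>p. G (fst p) - \<phi> (snd p) \<partial>\<pi>)"
    using i by simp
  also have "ennreal \<dots> \<le> (\<integral>\<^sup>+p. ennreal (G (fst p) - \<phi> (snd p)) \<partial>\<pi>)"
    by (rule ennreal_integral_le_nn_integral) (use i in auto)
  also have "\<dots> \<le> (\<integral>\<^sup>+ p. ennreal ((dist (fst p) (snd p))\<^sup>2) \<partial>\<pi>)"
    by (intro nn_integral_mono ennreal_leI) (use le in \<open>auto simp: algebra_simps\<close>)
  finally show "ennreal ((\<integral>x. G x \<partial>\<nu>) - (\<integral>y. \<phi> y \<partial>\<mu>))
      \<le> (\<integral>\<^sup>+ p. ennreal ((dist (fst p) (snd p))\<^sup>2) \<partial>\<pi>)" .
qed

definition T2 :: "'a::polish_space measure \<Rightarrow> real \<Rightarrow> bool" where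
  "T2 \<mu> c \<longleftrightarrow> (\<forall>\<nu>. prob_space \<nu> \<and> sets \<nu> = sets borel \<longrightarrow>
     enn2ereal (transport_cost2 \<nu> \<mu>) \<le> ereal c * rel_entropy \<nu> \<mu>)"

text \<open>By the Gibbs variational principle ln (int exp (a G) dmu) is the supremum of a int G dnu
  - H(nu|mu), attained at the tilted measure. Testing the transport inequality at this maximizer
  therefore gives the strongest bound that duality can yield for G and \<phi>.\<close>

lemma T2_exp_dual:
  fixes \<mu> :: "'a::polish_space measure" and G \<phi> :: "'a \<Rightarrow> real"
  assumes T2: "T2 \<mu> (1 / a)" and a: "a > 0"
    and \<mu>: "prob_space \<mu>" "sets \<mu> = sets borel"
    and G: "G \<in> borel_measurable borel" "\<And>x. \<bar>G x\<bar> \<le> B"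
    and \<phi>: "\<phi> \<in> borel_measurable borel" "\<And>x. \<bar>\<phi> x\<bar> \<le> B"
    and le: "\<And>x y. G x \<le> \<phi> y + (dist x y)\<^sup>2"
  shows "(\<integral>x. exp (a * G x) \<partial>\<mu>) \<le> exp (a * (\<integral>y. \<phi> y \<partial>\<mu>))"
proof -
  interpret prob_space \<mu> by fact
  note [measurable_cong] = \<mu>(2)
  note [measurable] = G(1) \<phi>(1)
  define Z where "Z = (\<integral>x. exp (a * G x) \<partial>\<mu>)"
  have bG: "\<bar>a * G x\<bar> \<le> a * B" for x
    using G(2)[of x] a by (simp add: abs_mult)
  have iE: "integrable \<mu> (\<lambda>x. exp (a * G x))"
  proof (rule integrable_bounded_prob[OF \<mu>(1), of _ "exp (a * B)"])
    fix x show "\<bar>exp (a * G x)\<bar> \<le> exp (a * B)" using bG[of x] by simp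
  qed measurable
  have "- (a * B) \<le> a * G x" for x using bG[of x] by linarith
  then have "exp (- (a * B)) \<le> Z"
    unfolding Z_def by (intro integral_ge_const iE AE_I2) simp
  then have Z: "Z > 0" using exp_gt_zero[of "-(a*B)"] by linarith
  define g where "g x = exp (a * G x) / Z" for x
  have g: "g \<in> borel_measurable \<mu>" "g x > 0" for x
    using Z by (auto simp: g_def[abs_def])
  define \<nu> where "\<nu> = density \<mu> g"
  have "emeasure \<nu> (space \<nu>) = (\<integral>\<^sup>+x. ennreal (g x) \<partial>\<mu>)"
    using g by (simp add: \<nu>_def emeasure_density cong: nn_integral_cong)
  also have "\<dots> = ennreal (\<integral>x. g x \<partial>\<mu>)"
    by (rule nn_integral_eq_integral) (use iE Z in \<open>auto simp: g_def\<close>)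
  also have "(\<integral>x. g x \<partial>\<mu>) = 1" using Z by (simp add: g_def Z_def)
  finally have \<nu>: "prob_space \<nu>" by (intro prob_spaceI) simp
  have s\<nu>: "sets \<nu> = sets borel" by (simp add: \<nu>_def \<mu>)
  note [measurable_cong] = s\<nu>
  have iG: "integrable \<nu> G" by (rule integrable_bounded_prob[OF \<nu> _ G(2)]) measurable
  interpret n: prob_space \<nu> by fact
  have lng: "ln (g x) = a * G x - ln Z" for x
    using Z by (simp add: g_def ln_div)
  have "integrable \<nu> (\<lambda>x. ln (g x))" using iG by (simp add: lng)
  then have "rel_entropy \<nu> \<mu> = ereal (\<integral>x. ln (g x) \<partial>\<nu>)"
    unfolding \<nu>_def by (rule rel_entropy_density[OF \<mu>(1) g])
  also have "(\<integral>x. ln (g x) \<partial>\<nu>) = a * (\<integral>x. G x \<partial>\<nu>) - ln Z"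
    using iG by (simp add: lng n.prob_space)
  finally have re: "rel_entropy \<nu> \<mu> = ereal (a * (\<integral>x. G x \<partial>\<nu>) - ln Z)" .
  \<comment> \<open>The difference of the means may be negative, and then \<open>ennreal\<close>
    turns it into 0; the inequality survives.\<close>
  have "ereal ((\<integral>x. G x \<partial>\<nu>) - (\<integral>y. \<phi> y \<partial>\<mu>)) \<le> enn2ereal (ennreal ((\<integral>x. G x \<partial>\<nu>) - (\<integral>y. \<phi> y \<partial>\<mu>)))"
    by (cases "(\<integral>x. G x \<partial>\<nu>) - (\<integral>y. \<phi> y \<partial>\<mu>) \<ge> 0") (simp_all add: ennreal_neg zero_ennreal.rep_eq)
  also have "\<dots> \<le> enn2ereal (transport_cost2 \<nu> \<mu>)"
    using transport_cost2_ge_dual[OF G \<phi> le] by (simp add: less_eq_ennreal.rep_eq)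
  also have "\<dots> \<le> ereal (1 / a) * rel_entropy \<nu> \<mu>"
    using T2 \<nu> s\<nu> unfolding T2_def by blast
  finally have "(\<integral>x. G x \<partial>\<nu>) - (\<integral>y. \<phi> y \<partial>\<mu>) \<le> (1 / a) * (a * (\<integral>x. G x \<partial>\<nu>) - ln Z)"
    unfolding re by simp
  \<comment> \<open>The mean of G under \<nu> occurs on both sides with coefficient 1 and cancels;
    this is why the tilt has the factor a.\<close>
  then have "ln Z \<le> a * (\<integral>y. \<phi> y \<partial>\<mu>)"
    using a by (simp add: field_simps)
  then have "Z \<le> exp (a * (\<integral>y. \<phi> y \<partial>\<mu>))"
    using Z by (metis exp_le_cancel_iff exp_ln)
  then show ?thesis by (simp add: Z_def)
qed

section \<open>Tensorization of the dual inequality\<close>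

lemma prob_space_prod_pow: "prob_space \<mu> \<Longrightarrow> prob_space (prod_pow \<mu> n)"
  unfolding prod_pow_def by (rule prob_space_PiM) auto

lemma measurable_prod_pow_upd [measurable]:
  "(\<lambda>(x, y). x(n := y)) \<in> measurable (prod_pow \<mu> n \<Otimes>\<^sub>M \<mu>) (prod_pow \<mu> (Suc n))"
  using measurable_add_dim[of n "{..<n}" "\<lambda>_. \<mu>"] by (simp add: prod_pow_def lessThan_Suc)

lemma integral_prod_pow_Suc:
  fixes f :: "_ \<Rightarrow> real"
  assumes "prob_space \<mu>" "integrable (prod_pow \<mu> (Suc n)) f"
  shows "(\<integral>x. f x \<partial>prod_pow \<mu> (Suc n)) = (\<integral>x. (\<integral>y. f (x(n := y)) \<partial>\<mu>) \<partial>prod_pow \<mu> n)"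
proof -
  interpret product_prob_space "\<lambda>_. \<mu>" "{..<n}"
    using assms(1) by (simp add: product_prob_space_def product_prob_space_axioms_def product_sigma_finite_def prob_space_imp_sigma_finite)
  show ?thesis
    using product_integral_insert[of "{..<n}" n f] assms(2) by (simp add: prod_pow_def lessThan_Suc)
qed

lemma integral_bound:
  fixes f :: "'a \<Rightarrow> real"
  assumes "prob_space M" "\<And>x. \<bar>f x\<bar> \<le> B"
  shows "\<bar>\<integral>x. f x \<partial>M\<bar> \<le> B"
proof (cases "integrable M f")
  case True
  interpret prob_space M by fact
  have "f x \<le> B" "- B \<le> f x" for x using assms(2)[of x] by linarith+
  then have "(\<integral>x. f x \<partial>M) \<le> B" "- B \<le> (\<integral>x. f x \<partial>M)"
    using True by (auto intro!: integral_le_const integral_ge_const)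
  then show ?thesis by (simp add: abs_le_iff)
next
  case False
  \<comment> \<open>A non-integrable function has Bochner integral 0, and any single value of f
    shows that B is nonnegative.\<close>
  then show ?thesis using assms(2)[of undefined] by (simp add: not_integrable_integral_eq)
qed

lemma rho2_nonneg: "0 \<le> rho2 n x y"
  by (simp add: rho2_def sum_nonneg)

lemma rho2_sq: "(rho2 n x y)\<^sup>2 = (\<Sum>i<n. (dist (x i) (y i))\<^sup>2)"
  by (simp add: rho2_def sum_nonneg)

text \<open>Additivity of the squared metric over coordinates is the reason why the quadratic cost
  passes to products with an unchanged constant.\<close>

lemma rho2_upd_sq: "(rho2 (Suc n) (x(n := u)) (y(n := v)))\<^sup>2 = (rho2 n x y)\<^sup>2 + (dist u v)\<^sup>2"
  by (simp add: rho2_sq)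

lemma T2_exp_dual_prod_pow:
  fixes \<mu> :: "'a::polish_space measure" and G \<phi> :: "(nat \<Rightarrow> 'a) \<Rightarrow> real"
  assumes T2: "T2 \<mu> (1 / a)" and a: "a > 0"
    and \<mu>: "prob_space \<mu>" "sets \<mu> = sets borel"
    and G: "G \<in> borel_measurable (prod_pow \<mu> n)" "\<And>x. \<bar>G x\<bar> \<le> B"
    and \<phi>: "\<phi> \<in> borel_measurable (prod_pow \<mu> n)" "\<And>x. \<bar>\<phi> x\<bar> \<le> B"
    and le: "\<And>x y. x \<in> space (prod_pow \<mu> n) \<Longrightarrow> y \<in> space (prod_pow \<mu> n)
      \<Longrightarrow> G x \<le> \<phi> y + (rho2 n x y)\<^sup>2"
  shows "(\<integral>x. exp (a * G x) \<partial>prod_pow \<mu> n) \<le> exp (a * (\<integral>y. \<phi> y \<partial>prod_pow \<mu> n))"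
  using G \<phi> le
proof (induction n arbitrary: G \<phi>)
  case 0
  have p: "prob_space (prod_pow \<mu> 0)" by (rule prob_space_prod_pow) fact
  have sp: "space (prod_pow \<mu> 0) = {\<lambda>_. undefined}"
    by (simp add: prod_pow_def space_PiM)
  have "(\<integral>x. f x \<partial>prod_pow \<mu> 0) = f (\<lambda>_. undefined)" for f :: "_ \<Rightarrow> real"
  proof -
    have "(\<integral>x. f x \<partial>prod_pow \<mu> 0) = (\<integral>x. f (\<lambda>_. undefined) \<partial>prod_pow \<mu> 0)"
      by (rule Bochner_Integration.integral_cong) (auto simp: sp)
    then show ?thesis using prob_space.prob_space[OF p] by simp
  qed
  then show ?case using 0(5)[of "\<lambda>_. undefined" "\<lambda>_. undefined"] a by (simp add: sp rho2_def)
next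
  case (Suc n)
  note [measurable] = Suc.prems(1,3)
  note [measurable_cong] = \<mu>(2)
  interpret prob_space \<mu> by fact
  have ps: "prob_space (prod_pow \<mu> k)" for k by (rule prob_space_prod_pow) fact
  have bG: "\<bar>a * G x\<bar> \<le> a * B" for x
    using Suc.prems(2)[of x] a by (simp add: abs_mult)
  have upd: "(\<lambda>y. x(n := y)) \<in> measurable borel (prod_pow \<mu> (Suc n))" if "x \<in> space (prod_pow \<mu> n)" for x
    using measurable_Pair2[OF measurable_prod_pow_upd[of n \<mu>] that] measurable_cong_sets[OF \<mu>(2) refl] by simp
  have upd_space: "x(n := y) \<in> space (prod_pow \<mu> (Suc n))" if "x \<in> space (prod_pow \<mu> n)" for x y
    using measurable_space[OF upd[OF that]] by simp
  \<comment> \<open>The last coordinate is integrated out of G through a logarithmic Laplace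
    transform and out of \<phi> through a plain mean. The first choice makes exp (a H) integrate to
    the left side, the second preserves the mean on the right.\<close>
  define E where "E x = (\<integral>y. exp (a * G (x(n := y))) \<partial>\<mu>)" for x
  define H where "H x = ln (E x) / a" for x
  define \<psi> where "\<psi> x = (\<integral>y. \<phi> (x(n := y)) \<partial>\<mu>)" for x
  have iE: "integrable \<mu> (\<lambda>y. exp (a * G (x(n := y))))" if "x \<in> space (prod_pow \<mu> n)" for x
  proof (rule integrable_bounded_prob[OF \<mu>(1), of _ "exp (a * B)"])
    note [measurable] = upd[OF that]
    show "(\<lambda>y. exp (a * G (x(n := y)))) \<in> borel_measurable \<mu>" by measurable
    fix y show "\<bar>exp (a * G (x(n := y)))\<bar> \<le> exp (a * B)"
      using bG[of "x(n := y)"] by simp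
  qed
  have E_bd: "exp (- (a * B)) \<le> E x \<and> E x \<le> exp (a * B)" if "x \<in> space (prod_pow \<mu> n)" for x
  proof -
    have "a * G (x(n := y)) \<le> a * B" "- (a * B) \<le> a * G (x(n := y))" for y
      using bG[of "x(n := y)"] by linarith+
    then show ?thesis
      unfolding E_def using iE[OF that] by (auto intro!: integral_le_const integral_ge_const)
  qed
  have E_pos: "0 < E x" if "x \<in> space (prod_pow \<mu> n)" for x
    using E_bd[OF that] exp_gt_zero[of "-(a*B)"] by linarith
  have Em[measurable]: "E \<in> borel_measurable (prod_pow \<mu> n)"
  proof -
    have "(\<lambda>x. \<integral>y. (\<lambda>(x, y). exp (a * G (x(n := y)))) (x, y) \<partial>\<mu>) \<in> borel_measurable (prod_pow \<mu> n)"
      by (rule borel_measurable_lebesgue_integral) measurable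
    then show ?thesis by (simp add: E_def[abs_def])
  qed
  have \<psi>m[measurable]: "\<psi> \<in> borel_measurable (prod_pow \<mu> n)"
  proof -
    have "(\<lambda>x. \<integral>y. (\<lambda>(x, y). \<phi> (x(n := y))) (x, y) \<partial>\<mu>) \<in> borel_measurable (prod_pow \<mu> n)"
      by (rule borel_measurable_lebesgue_integral) measurable
    then show ?thesis by (simp add: \<psi>_def[abs_def])
  qed
  \<comment> \<open>The induction hypothesis asks for the bound B at every function, while
    \<open>E\<close> is estimated only on the space of the product. Clamping provides the bound
    everywhere and changes nothing on that space.\<close>
  define H' where "H' x = max (-B) (min B (H x))" for x
  have B: "0 \<le> B" using Suc.prems(2)[of undefined] by linarith
  have H'H: "exp (a * H' x) = E x" if "x \<in> space (prod_pow \<mu> n)" for x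
  proof -
    have "- (a * B) \<le> ln (E x)"
      using E_bd[OF that] E_pos[OF that] by (simp add: ln_ge_iff)
    moreover have "ln (E x) \<le> ln (exp (a * B))"
      using E_bd[OF that] E_pos[OF that] by (intro ln_mono) auto
    ultimately have "- (a * B) \<le> ln (E x)" "ln (E x) \<le> a * B" by auto
    then have "- B \<le> H x" "H x \<le> B" using a by (auto simp: H_def field_simps)
    then have "a * H' x = ln (E x)" using a by (auto simp: H'_def H_def)
    then show ?thesis using E_pos[OF that] by simp
  qed
  have H'm: "H' \<in> borel_measurable (prod_pow \<mu> n)" by (simp add: H'_def[abs_def] H_def)
  have H'b: "\<bar>H' x\<bar> \<le> B" for x using B by (auto simp: H'_def)
  have \<psi>b: "\<bar>\<psi> x\<bar> \<le> B" for x
    unfolding \<psi>_def by (rule integral_bound[OF \<mu>(1)]) (rule Suc.prems)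
  have key: "H' x \<le> \<psi> y + (rho2 n x y)\<^sup>2"
    if xy: "x \<in> space (prod_pow \<mu> n)" "y \<in> space (prod_pow \<mu> n)" for x y
  proof -
    note [measurable] = upd[OF xy(1)] upd[OF xy(2)]
    let ?r = "(rho2 n x y)\<^sup>2"
    have "(\<integral>u. exp (a * (G (x(n := u)) - ?r)) \<partial>\<mu>) \<le> exp (a * (\<integral>v. \<phi> (y(n := v)) \<partial>\<mu>))"
    proof (rule T2_exp_dual[OF T2 a \<mu>, where B = "B + ?r"])
      fix u show "\<bar>G (x(n := u)) - ?r\<bar> \<le> B + ?r"
        using Suc.prems(2)[of "x(n := u)"] zero_le_power2[of "rho2 n x y"] by linarith
      show "\<bar>\<phi> (y(n := u))\<bar> \<le> B + ?r"
        using Suc.prems(4)[of "y(n := u)"] zero_le_power2[of "rho2 n x y"] by linarith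
      fix v show "G (x(n := u)) - ?r \<le> \<phi> (y(n := v)) + (dist u v)\<^sup>2"
        using Suc.prems(5)[OF upd_space[OF xy(1), of u] upd_space[OF xy(2), of v]]
        unfolding rho2_upd_sq by linarith
    qed measurable
    also have "(\<lambda>u. exp (a * (G (x(n := u)) - ?r))) = (\<lambda>u. exp (- (a * ?r)) * exp (a * G (x(n := u))))"
      by (simp add: exp_add[symmetric] algebra_simps)
    finally have "exp (- (a * ?r)) * E x \<le> exp (a * \<psi> y)"
      unfolding E_def \<psi>_def by (simp only: integral_mult_right_zero)
    then have "exp (a * H' x) \<le> exp (a * ?r) * exp (a * \<psi> y)"
      by (simp add: H'H[OF xy(1)] exp_minus field_simps)
    then have "a * H' x \<le> a * (\<psi> y + ?r)"
      by (simp add: exp_add[symmetric] algebra_simps)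
    then show ?thesis using a by simp
  qed
  have "(\<integral>x. exp (a * G x) \<partial>prod_pow \<mu> (Suc n)) = (\<integral>x. E x \<partial>prod_pow \<mu> n)"
    unfolding E_def
  proof (rule integral_prod_pow_Suc[OF \<mu>(1)])
    show "integrable (prod_pow \<mu> (Suc n)) (\<lambda>x. exp (a * G x))"
    proof (rule integrable_bounded_prob[OF ps, of _ _ "exp (a * B)"])
      fix x show "\<bar>exp (a * G x)\<bar> \<le> exp (a * B)" using bG[of x] by simp
    qed measurable
  qed
  also have "\<dots> = (\<integral>x. exp (a * H' x) \<partial>prod_pow \<mu> n)"
    by (rule Bochner_Integration.integral_cong) (auto simp: H'H)
  also have "\<dots> \<le> exp (a * (\<integral>y. \<psi> y \<partial>prod_pow \<mu> n))"
    by (rule Suc.IH[OF H'm H'b \<psi>m \<psi>b key])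
  also have "(\<integral>y. \<psi> y \<partial>prod_pow \<mu> n) = (\<integral>x. \<phi> x \<partial>prod_pow \<mu> (Suc n))"
    unfolding \<psi>_def
    by (rule integral_prod_pow_Suc[OF \<mu>(1), symmetric]) (rule integrable_bounded_prob[OF ps Suc.prems(3,4)])
  finally show ?case .
qed

section \<open>Lipschitz functions on the product and their Gaussian deviations\<close>

lemma rho2_conv_L2_set: "rho2 n x y = L2_set (\<lambda>i. dist (x i) (y i)) {..<n}"
  by (simp add: rho2_def L2_set_def)

lemma rho2_commute: "rho2 n x y = rho2 n y x"
  by (simp add: rho2_def dist_commute)

lemma rho2_refl [simp]: "rho2 n x x = 0"
  by (simp add: rho2_def)

lemma rho2_triangle: "rho2 n x z \<le> rho2 n x y + rho2 n y z"
proof -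
  have "rho2 n x z \<le> L2_set (\<lambda>i. dist (x i) (y i) + dist (y i) (z i)) {..<n}"
    unfolding rho2_conv_L2_set by (rule L2_set_mono) (auto simp: dist_triangle)
  also have "\<dots> \<le> rho2 n x y + rho2 n y z"
    unfolding rho2_conv_L2_set by (rule L2_set_triangle_ineq)
  finally show ?thesis .
qed

lemma measurable_prod_pow_component:
  assumes "sets \<mu> = sets borel" "i < n"
  shows "(\<lambda>x. x i) \<in> measurable (prod_pow \<mu> n) borel"
proof -
  have "(\<lambda>x. x i) \<in> measurable (prod_pow \<mu> n) \<mu>"
    unfolding prod_pow_def using assms(2) by (intro measurable_component_singleton) auto
  then show ?thesis using measurable_cong_sets[OF refl assms(1)] by blast
qed

lemma borel_measurable_rho2:
  fixes \<mu> :: "'a::polish_space measure"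
  assumes "sets \<mu> = sets borel"
  shows "(\<lambda>x. rho2 n x z) \<in> borel_measurable (prod_pow \<mu> n)"
  unfolding rho2_def
  by (intro measurable_compose[OF _ borel_measurable_continuous_onI[OF continuous_on_real_sqrt[OF continuous_on_id]]]
      borel_measurable_sum borel_measurable_power borel_measurable_dist
      borel_measurable_const measurable_prod_pow_component assms) auto

text \<open>A 1-Lipschitz F is the infimum of the functions F z + rho2 (., z) over a countable dense
  set of z. Each of these is measurable for the product sigma-algebra, so the Borel sets of the
  product metric need not be described.\<close>

lemma rho2_Lipschitz_measurable:
  fixes \<mu> :: "'a::polish_space measure" and F :: "(nat \<Rightarrow> 'a) \<Rightarrow> real"
  assumes s: "sets \<mu> = sets borel"
    and F: "\<And>x y. F x \<le> F y + rho2 n x y"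
  shows "F \<in> borel_measurable (prod_pow \<mu> n)"
proof -
  obtain D :: "'a set" where D: "countable D" "\<And>X. open X \<Longrightarrow> X \<noteq> {} \<Longrightarrow> \<exists>d\<in>D. d \<in> X"
    by (erule countable_dense_setE)
  \<comment> \<open>Extensional functions keep the set of grid points countable: values outside the
    first n indices do not influence \<open>rho2\<close> but would make it uncountable.\<close>
  define Dn where "Dn = PiE {..<n} (\<lambda>_. D)"
  have cDn: "countable Dn" unfolding Dn_def by (rule countable_PiE) (use D in auto)
  have dense: "\<exists>z\<in>Dn. rho2 n x z < e" if "e > 0" for x and e :: real
  proof -
    \<comment> \<open>Dividing by n + 1 makes the sum of n such radii strictly smaller than e and
      covers n = 0.\<close>
    have "\<exists>d\<in>D. d \<in> ball (x i) (e / (n + 1))" for i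
      using that by (intro D(2)) (auto simp: divide_le_0_iff)
    then obtain z where z: "\<And>i. z i \<in> D" "\<And>i. dist (x i) (z i) < e / (n + 1)"
      by (metis mem_ball)
    have "rho2 n x (restrict z {..<n}) \<le> (\<Sum>i<n. dist (x i) (restrict z {..<n} i))"
      unfolding rho2_conv_L2_set by (rule L2_set_le_sum) auto
    also have "\<dots> \<le> (\<Sum>i<n. e / (n + 1))"
      by (rule sum_mono) (use z in \<open>auto intro: less_imp_le\<close>)
    also have "\<dots> < e" using that by (simp add: field_simps)
    finally show ?thesis using z(1) by (intro bexI[of _ "restrict z {..<n}"]) (auto simp: Dn_def)
  qed
  have ne: "Dn \<noteq> {}" using dense[of 1 undefined] by auto
  have bdd: "bdd_below ((\<lambda>z. F z + rho2 n x z) ` Dn)" for x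
    using F[of x] by (intro bdd_belowI2[of _ "F x"]) auto
  have eq: "F x = (INF z\<in>Dn. F z + rho2 n x z)" for x
  proof (rule antisym)
    show "F x \<le> (INF z\<in>Dn. F z + rho2 n x z)"
      by (rule cINF_greatest[OF ne]) (use F in auto)
    show "(INF z\<in>Dn. F z + rho2 n x z) \<le> F x"
    proof (rule field_le_epsilon)
      fix e :: real assume "e > 0"
      then obtain z where z: "z \<in> Dn" "rho2 n x z < e / 2" using dense[of "e/2" x] by auto
      have "(INF z\<in>Dn. F z + rho2 n x z) \<le> F z + rho2 n x z"
        by (rule cINF_lower[OF bdd z(1)])
      also have "\<dots> \<le> F x + e" using F[of z x] z(2) by (simp add: rho2_commute[of n z])
      finally show "(INF z\<in>Dn. F z + rho2 n x z) \<le> F x + e" .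
    qed
  qed
  have "(\<lambda>x. INF z\<in>Dn. F z + rho2 n x z) \<in> borel_measurable (prod_pow \<mu> n)"
    by (intro borel_measurable_cINF cDn bdd borel_measurable_add borel_measurable_const
        borel_measurable_rho2 s)
  then show ?thesis by (simp add: eq[symmetric])
qed

text \<open>Chernoff's method. For a multiplier k the inequality k rho <= rho^2 + k^2 / 4 makes k F
  - k^2 / 4 and k F an admissible pair, and Markov's inequality leaves the exponent a (k^2 / 4 - k
  s). Its minimum is at k = 2 s, with value - a s^2.\<close>

lemma T2_deviation:
  fixes \<mu> :: "'a::polish_space measure" and F :: "(nat \<Rightarrow> 'a) \<Rightarrow> real"
  assumes T2: "T2 \<mu> (1 / a)" and a: "a > 0"
    and \<mu>: "prob_space \<mu>" "sets \<mu> = sets borel"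
    and F: "\<And>x y. F x \<le> F y + rho2 n x y" "\<And>x. \<bar>F x\<bar> \<le> B"
    and m: "m = (\<integral>x. F x \<partial>prod_pow \<mu> n)" and s: "s \<ge> 0"
  shows "measure (prod_pow \<mu> n) {x \<in> space (prod_pow \<mu> n). m + s \<le> F x} \<le> exp (- a * s\<^sup>2)"
proof -
  let ?M = "prod_pow \<mu> n"
  have p: "prob_space ?M" by (rule prob_space_prod_pow) fact
  interpret prob_space ?M by fact
  have Fm[measurable]: "F \<in> borel_measurable ?M"
    by (rule rho2_Lipschitz_measurable[OF \<mu>(2) F(1)])
  have bF: "- B \<le> F x" "F x \<le> B" for x using F(2)[of x] by linarith+
  have iE: "integrable ?M (\<lambda>x. exp (a * (2 * s * F x)))"
  proof (rule integrable_bounded_prob[OF p, of _ "exp (a * (2 * s * B))"])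
    fix x show "\<bar>exp (a * (2 * s * F x))\<bar> \<le> exp (a * (2 * s * B))"
      using bF[of x] a s by (simp add: mult_left_mono)
  qed measurable
  have "(\<integral>x. exp (a * (2 * s * F x - s\<^sup>2)) \<partial>?M) \<le> exp (a * (\<integral>y. 2 * s * F y \<partial>?M))"
  proof (rule T2_exp_dual_prod_pow[OF T2 a \<mu>, where B = "2 * s * B + s\<^sup>2"])
    fix x y
    have *: "\<bar>2 * s * F x\<bar> \<le> 2 * s * B" for x
      using F(2)[of x] s by (simp add: abs_mult mult_left_mono)
    show "\<bar>2 * s * F x - s\<^sup>2\<bar> \<le> 2 * s * B + s\<^sup>2" using *[of x] zero_le_power2[of s] by linarith
    show "\<bar>2 * s * F x\<bar> \<le> 2 * s * B + s\<^sup>2" using *[of x] zero_le_power2[of s] by linarith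
    have "2 * s * F x \<le> 2 * s * (F y + rho2 n x y)"
      using F(1)[of x y] s by (intro mult_left_mono) auto
    moreover have "2 * s * rho2 n x y \<le> (rho2 n x y)\<^sup>2 + s\<^sup>2"
      using sum_squares_bound[of s "rho2 n x y"] by (simp add: ac_simps)
    ultimately show "2 * s * F x - s\<^sup>2 \<le> 2 * s * F y + (rho2 n x y)\<^sup>2"
      by (simp add: distrib_left)
  qed measurable
  also have "(\<integral>x. exp (a * (2 * s * F x - s\<^sup>2)) \<partial>?M)
      = (\<integral>x. exp (- (a * s\<^sup>2)) * exp (a * (2 * s * F x)) \<partial>?M)"
    by (simp add: exp_add[symmetric] algebra_simps)
  finally have E: "exp (- (a * s\<^sup>2)) * (\<integral>x. exp (a * (2 * s * F x)) \<partial>?M) \<le> exp (a * (2 * s * m))"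
    using m by simp
  have "{x \<in> space ?M. m + s \<le> F x}
      \<subseteq> {x \<in> space ?M. exp (a * (2 * s * (m + s))) \<le> exp (a * (2 * s * F x))}"
    using a s by (auto intro!: mult_left_mono)
  then have "measure ?M {x \<in> space ?M. m + s \<le> F x}
      \<le> measure ?M {x \<in> space ?M. exp (a * (2 * s * (m + s))) \<le> exp (a * (2 * s * F x))}"
    by (intro finite_measure_mono) measurable
  also have "\<dots> \<le> (\<integral>x. exp (a * (2 * s * F x)) \<partial>?M) / exp (a * (2 * s * (m + s)))"
    by (rule integral_Markov_inequality_measure[OF iE, of "{}"]) auto
  also have "\<dots> \<le> exp (a * (2 * s * m)) * exp (a * s\<^sup>2) / exp (a * (2 * s * (m + s)))"
    using E by (intro divide_right_mono) (auto simp: exp_minus field_simps)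
  also have "\<dots> = exp (a * (2 * s * m) + a * s\<^sup>2 - a * (2 * s * (m + s)))"
    by (simp add: exp_add exp_diff)
  also have "a * (2 * s * m) + a * s\<^sup>2 - a * (2 * s * (m + s)) = - a * s\<^sup>2"
    by (simp add: algebra_simps power2_eq_square)
  finally show ?thesis .
qed

definition concentration :: "'a::polish_space measure \<Rightarrow> real \<Rightarrow> real \<Rightarrow> real \<Rightarrow> bool" where
  "concentration \<mu> a r\<^sub>o b \<longleftrightarrow> (\<forall>n \<ge> 1. \<forall>A \<in> sets (prod_pow \<mu> n).
     measure (prod_pow \<mu> n) A \<ge> 1/2 \<longrightarrow>
     (\<forall>r \<ge> r\<^sub>o. outer_measure (prod_pow \<mu> n) (enlarge \<mu> n A r) \<ge> 1 - b * exp (- a * (r - r\<^sub>o)\<^sup>2)))"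

theorem T2_imp_concentration:
  fixes \<mu> :: "'a::polish_space measure"
  assumes T2: "T2 \<mu> (1 / a)" and a: "a > 0"
    and \<mu>: "prob_space \<mu>" "sets \<mu> = sets borel"
  shows "concentration \<mu> a (sqrt (ln 2 / a)) 1"
  unfolding concentration_def
proof (intro allI ballI impI)
  fix n A r assume A: "A \<in> sets (prod_pow \<mu> n)" "measure (prod_pow \<mu> n) A \<ge> 1/2"
    and r: "sqrt (ln 2 / a) \<le> r"
  let ?M = "prod_pow \<mu> n" and ?r\<^sub>o = "sqrt (ln 2 / a)"
  have r0: "0 \<le> ?r\<^sub>o" using a by simp
  interpret prob_space ?M by (rule prob_space_prod_pow) fact
  have ne: "A \<noteq> {}" using A(2) by auto
  define d where "d x = (INF y\<in>A. rho2 n x y)" for x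
  \<comment> \<open>Truncation at r supplies the bounded function that the deviation estimate
    requires and leaves the event that the distance is at least r unchanged.\<close>
  define F where "F x = min (d x) r" for x
  have bdd: "bdd_below (rho2 n x ` A)" for x
    by (intro bdd_belowI2[of _ 0] rho2_nonneg)
  have d_lip: "d x \<le> d y + rho2 n x y" for x y
  proof -
    have "d x - rho2 n x y \<le> (INF z\<in>A. rho2 n y z)"
    proof (rule cINF_greatest[OF ne])
      fix z assume "z \<in> A"
      then have "d x \<le> rho2 n x z" unfolding d_def by (rule cINF_lower[OF bdd])
      also have "\<dots> \<le> rho2 n x y + rho2 n y z" by (rule rho2_triangle)
      finally show "d x - rho2 n x y \<le> rho2 n y z" by simp
    qed
    then show ?thesis by (simp add: d_def)
  qed
  have d0: "0 \<le> d x" for x unfolding d_def by (rule cINF_greatest[OF ne rho2_nonneg])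
  have F_lip: "F x \<le> F y + rho2 n x y" for x y
    using d_lip[of x y] rho2_nonneg[of n x y] by (auto simp: F_def min_def)
  have F_lip': "- F x \<le> - F y + rho2 n x y" for x y
    using F_lip[of y x] by (simp add: rho2_commute)
  have Fb: "\<bar>F x\<bar> \<le> r" "\<bar>- F x\<bar> \<le> r" "0 \<le> F x" for x
    using d0[of x] r r0 order_trans[OF r0 r] by (auto simp: F_def min_def)
  have Fm[measurable]: "F \<in> borel_measurable ?M"
    by (rule rho2_Lipschitz_measurable[OF \<mu>(2) F_lip])
  define m where "m = (\<integral>x. F x \<partial>?M)"
  have m0: "0 \<le> m" unfolding m_def using Fb by (intro integral_nonneg_AE) auto
  \<comment> \<open>On A the function - F is 0, that is, it exceeds its mean - m by exactly m. Since
    A has mass at least 1/2, the deviation bound at s = m limits m.\<close>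
  have "A \<subseteq> {x \<in> space ?M. - m + m \<le> - F x}"
  proof
    fix x assume x: "x \<in> A"
    have "d x \<le> rho2 n x x" unfolding d_def using x by (rule cINF_lower[OF bdd])
    then have "F x \<le> 0" by (simp add: F_def)
    then show "x \<in> {x \<in> space ?M. - m + m \<le> - F x}" using sets.sets_into_space[OF A(1)] x by auto
  qed
  then have "1/2 \<le> measure ?M {x \<in> space ?M. - m + m \<le> - F x}"
    using A(2) finite_measure_mono[of A "{x \<in> space ?M. - m + m \<le> - F x}"] by force
  also have "\<dots> \<le> exp (- a * m\<^sup>2)"
    by (rule T2_deviation[OF T2 a \<mu> F_lip' Fb(2)]) (auto simp: m_def m0[unfolded m_def])
  finally have "ln (1/2) \<le> - a * m\<^sup>2"
    by (metis ln_exp ln_le_cancel_iff exp_gt_zero half_gt_zero zero_less_one)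
  then have "m\<^sup>2 \<le> ln 2 / a" using a by (simp add: ln_div field_simps)
  then have m_le: "m \<le> ?r\<^sub>o" by (rule real_le_rsqrt)
  have "measure ?M {x \<in> space ?M. m + (r - m) \<le> F x} \<le> exp (- a * (r - m)\<^sup>2)"
    by (rule T2_deviation[OF T2 a \<mu> F_lip Fb(1)]) (use m_le r in \<open>auto simp: m_def\<close>)
  also have "\<dots> \<le> exp (- a * (r - ?r\<^sub>o)\<^sup>2)"
    using a m_le r by (auto intro!: mult_left_mono power_mono)
  finally have tail: "measure ?M {x \<in> space ?M. r \<le> F x} \<le> exp (- a * (r - ?r\<^sub>o)\<^sup>2)" by simp
  \<comment> \<open>The outer measure is an infimum over measurable supersets, so each superset is
    bounded below. Its complement lies in {F >= r}: a distance strictly below r is witnessed by a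
    point of A even if the infimum is not attained.\<close>
  have "1 - exp (- a * (r - ?r\<^sub>o)\<^sup>2) \<le> measure ?M C"
    if C: "C \<in> sets ?M" "enlarge \<mu> n A r \<subseteq> C" for C
  proof -
    have "space ?M - C \<subseteq> {x \<in> space ?M. r \<le> F x}"
    proof (rule subsetI, rule ccontr)
      fix x assume x: "x \<in> space ?M - C" "x \<notin> {x \<in> space ?M. r \<le> F x}"
      then have "d x < r" by (auto simp: F_def min_def split: if_splits)
      then obtain y where "y \<in> A" "rho2 n x y < r"
        unfolding d_def using cINF_less_iff[OF ne bdd] by blast
      then have "x \<in> enlarge \<mu> n A r" using x by (auto simp: enlarge_def intro: less_imp_le)
      then show False using C x by auto
    qed
    then have "measure ?M (space ?M - C) \<le> measure ?M {x \<in> space ?M. r \<le> F x}"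
      by (rule finite_measure_mono) measurable
    then show ?thesis using tail C by (simp add: prob_compl)
  qed
  moreover have "enlarge \<mu> n A r \<subseteq> space ?M" by (auto simp: enlarge_def)
  ultimately show "1 - 1 * exp (- a * (r - ?r\<^sub>o)\<^sup>2) \<le> outer_measure ?M (enlarge \<mu> n A r)"
    unfolding outer_measure_def by (intro cInf_greatest) auto
qed

section \<open>Law of large numbers and the lower bound in Sanov's theorem\<close>

definition emp_avg :: "nat \<Rightarrow> ('a \<Rightarrow> real) \<Rightarrow> (nat \<Rightarrow> 'a) \<Rightarrow> real" where
  "emp_avg n f x = (\<Sum>i<n. f (x i)) / n"

lemma borel_measurable_prod_pow_component:
  assumes "f \<in> borel_measurable \<mu>" "i < n"
  shows "(\<lambda>x. f (x i)) \<in> borel_measurable (prod_pow \<mu> n)"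
  unfolding prod_pow_def
  by (rule measurable_compose[where f = "\<lambda>x. x i", OF _ assms(1)])
    (use assms(2) in \<open>auto intro: measurable_component_singleton\<close>)

lemma borel_measurable_sum_prod_pow:
  assumes "f \<in> borel_measurable \<mu>"
  shows "(\<lambda>x. \<Sum>i<n. f (x i) :: real) \<in> borel_measurable (prod_pow \<mu> n)"
  using borel_measurable_prod_pow_component[OF assms] by (intro borel_measurable_sum) auto

lemma borel_measurable_emp_avg:
  assumes "f \<in> borel_measurable \<mu>"
  shows "emp_avg n f \<in> borel_measurable (prod_pow \<mu> n)"
  unfolding emp_avg_def[abs_def]
  by (intro borel_measurable_divide borel_measurable_const borel_measurable_sum_prod_pow assms)

lemma
  fixes f :: "'a \<Rightarrow> real"
  assumes "prob_space \<mu>" "integrable \<mu> f" "i < n"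
  shows integrable_prod_pow_component: "integrable (prod_pow \<mu> n) (\<lambda>x. f (x i))"
    and integral_prod_pow_component: "(\<integral>x. f (x i) \<partial>prod_pow \<mu> n) = (\<integral>x. f x \<partial>\<mu>)"
proof -
  have d: "distr (prod_pow \<mu> n) \<mu> (\<lambda>x. x i) = \<mu>"
    unfolding prod_pow_def using assms by (intro distr_PiM_component) auto
  have m: "(\<lambda>x. x i) \<in> measurable (prod_pow \<mu> n) \<mu>"
    unfolding prod_pow_def using assms by (intro measurable_component_singleton) auto
  have "integrable (distr (prod_pow \<mu> n) \<mu> (\<lambda>x. x i)) f" using d assms by simp
  then show "integrable (prod_pow \<mu> n) (\<lambda>x. f (x i))"
    by (subst (asm) integrable_distr_eq) (use m assms in auto)
  show "(\<integral>x. f (x i) \<partial>prod_pow \<mu> n) = (\<integral>x. f x \<partial>\<mu>)"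
    using integral_distr[OF m, of f] d assms by auto
qed

text \<open>Variances of independent centred terms add up: integrating out the last coordinate kills
  the cross term, because f has mean 0.\<close>

lemma second_moment_sum_prod_pow:
  fixes f :: "'a \<Rightarrow> real"
  assumes \<mu>: "prob_space \<mu>" and f: "f \<in> borel_measurable \<mu>" "\<And>x. \<bar>f x\<bar> \<le> B" "(\<integral>x. f x \<partial>\<mu>) = 0"
  shows "integrable (prod_pow \<mu> n) (\<lambda>x. (\<Sum>i<n. f (x i))\<^sup>2)
    \<and> (\<integral>x. (\<Sum>i<n. f (x i))\<^sup>2 \<partial>prod_pow \<mu> n) = n * (\<integral>x. (f x)\<^sup>2 \<partial>\<mu>)"
proof (induction n)
  case 0
  then show ?case by simp
next
  case (Suc n)
  interpret prob_space \<mu> by fact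
  have p: "prob_space (prod_pow \<mu> k)" for k by (rule prob_space_prod_pow) fact
  interpret P: prob_space "prod_pow \<mu> n" by (rule p)
  have i: "integrable (prod_pow \<mu> k) (\<lambda>x. (\<Sum>i<k. f (x i))\<^sup>2)" for k
  proof (rule integrable_bounded_prob[OF p, of _ _ "(k * B)\<^sup>2"])
    show "(\<lambda>x. (\<Sum>i<k. f (x i))\<^sup>2) \<in> borel_measurable (prod_pow \<mu> k)"
      using borel_measurable_sum_prod_pow[OF f(1)] by measurable
    fix x :: "nat \<Rightarrow> 'a"
    have "\<bar>\<Sum>i<k. f (x i)\<bar> \<le> (\<Sum>i<k. \<bar>f (x i)\<bar>)" by (rule sum_abs)
    also have "\<dots> \<le> (\<Sum>i<k. B)" by (rule sum_mono) (rule f)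
    finally show "\<bar>(\<Sum>i<k. f (x i))\<^sup>2\<bar> \<le> (k * B)\<^sup>2"
      using power_mono[of "\<bar>\<Sum>i<k. f (x i)\<bar>" "k * B" 2] by simp
  qed
  have i1: "integrable \<mu> f" by (rule integrable_bounded_prob[OF \<mu> f(1,2)])
  have i2: "integrable \<mu> (\<lambda>x. (f x)\<^sup>2)"
    by (rule integrable_bounded_prob[OF \<mu>, of _ "B\<^sup>2"])
      (use f(1) power_mono[OF f(2), of _ 2] in auto)
  have "(\<integral>x. (\<Sum>i<Suc n. f (x i))\<^sup>2 \<partial>prod_pow \<mu> (Suc n))
      = (\<integral>x. \<integral>y. (\<Sum>i<Suc n. f ((x(n := y)) i))\<^sup>2 \<partial>\<mu> \<partial>prod_pow \<mu> n)"
    by (rule integral_prod_pow_Suc[OF \<mu> i])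
  also have "\<dots> = (\<integral>x. \<integral>y. (\<Sum>i<n. f (x i))\<^sup>2 + 2 * (\<Sum>i<n. f (x i)) * f y + (f y)\<^sup>2 \<partial>\<mu> \<partial>prod_pow \<mu> n)"
    by (simp add: power2_sum algebra_simps)
  also have "\<dots> = (\<integral>x. (\<Sum>i<n. f (x i))\<^sup>2 + (\<integral>y. (f y)\<^sup>2 \<partial>\<mu>) \<partial>prod_pow \<mu> n)"
    using i1 i2 by (simp add: f(3) prob_space)
  also have "\<dots> = Suc n * (\<integral>y. (f y)\<^sup>2 \<partial>\<mu>)"
    using i[of n] Suc.IH by (simp add: P.prob_space algebra_simps)
  finally show ?case using i[of "Suc n"] by blast
qed

text \<open>Chebyshev's inequality for the centred function, whose absolute value is at most 2
  B.\<close>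

lemma weak_law_bounded:
  fixes f :: "'a \<Rightarrow> real"
  assumes \<mu>: "prob_space \<mu>" and f: "f \<in> borel_measurable \<mu>" "\<And>x. \<bar>f x\<bar> \<le> B"
    and e: "e > 0" and n: "n \<ge> 1"
  shows "measure (prod_pow \<mu> n) {x \<in> space (prod_pow \<mu> n). e \<le> \<bar>emp_avg n f x - (\<integral>x. f x \<partial>\<mu>)\<bar>}
    \<le> (2 * B)\<^sup>2 / (n * e\<^sup>2)"
proof -
  interpret prob_space \<mu> by fact
  have p: "prob_space (prod_pow \<mu> n)" by (rule prob_space_prod_pow) fact
  interpret P: prob_space "prod_pow \<mu> n" by (rule p)
  define m where "m = (\<integral>x. f x \<partial>\<mu>)"
  define g where "g x = f x - m" for x
  have i1: "integrable \<mu> f" by (rule integrable_bounded_prob[OF \<mu> f])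
  have mB: "\<bar>m\<bar> \<le> B" unfolding m_def by (rule integral_bound[OF \<mu> f(2)])
  have g: "g \<in> borel_measurable \<mu>" "\<bar>g x\<bar> \<le> 2 * B" "(\<integral>x. g x \<partial>\<mu>) = 0" for x
  proof -
    show "\<bar>g x\<bar> \<le> 2 * B" using mB f(2)[of x] unfolding g_def by linarith
  qed (use f i1 in \<open>auto simp: g_def[abs_def] m_def prob_space\<close>)
  note s = second_moment_sum_prod_pow[OF \<mu> g, of n]
  have gm: "(\<lambda>x. \<Sum>i<n. g (x i)) \<in> borel_measurable (prod_pow \<mu> n)"
    by (rule borel_measurable_sum_prod_pow[OF g(1)])
  have g2: "(\<integral>x. (g x)\<^sup>2 \<partial>\<mu>) \<le> (2 * B)\<^sup>2"
  proof -
    have "\<bar>(g x)\<^sup>2\<bar> \<le> (2 * B)\<^sup>2" for x using power_mono[OF g(2)[of x], of 2] by simp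
    then show ?thesis by (intro abs_le_D1[OF integral_bound[OF \<mu>]])
  qed
  have "emp_avg n f x - m = (\<Sum>i<n. g (x i)) / n" for x
    using n by (simp add: emp_avg_def g_def sum_subtractf field_simps)
  then have "e \<le> \<bar>emp_avg n f x - m\<bar> \<longleftrightarrow> n * e \<le> \<bar>\<Sum>i<n. g (x i)\<bar>" for x
    using n by (simp add: pos_le_divide_eq mult.commute)
  then have "{x \<in> space (prod_pow \<mu> n). e \<le> \<bar>emp_avg n f x - m\<bar>}
      = {x \<in> space (prod_pow \<mu> n). n * e \<le> \<bar>\<Sum>i<n. g (x i)\<bar>}"
    by simp
  also have "measure (prod_pow \<mu> n) \<dots> \<le> (\<integral>x. (\<Sum>i<n. g (x i))\<^sup>2 \<partial>prod_pow \<mu> n) / (n * e)\<^sup>2"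
    by (rule P.second_moment_method[OF gm]) (use s n e in auto)
  also have "\<dots> = (\<integral>x. (g x)\<^sup>2 \<partial>\<mu>) / (n * e\<^sup>2)"
    using s n by (simp add: power_mult_distrib power2_eq_square)
  also have "\<dots> \<le> (2 * B)\<^sup>2 / (n * e\<^sup>2)"
    using g2 n e by (intro divide_right_mono) auto
  finally show ?thesis by (simp add: m_def)
qed

text \<open>Integrability is all that is available for test functions such as ln h under \<nu>. So f
  is truncated at a level k: the bounded part obeys Chebyshev's bound, and the remainder is small in
  L1, which Markov's inequality turns into smallness in probability uniformly in n.\<close>

theorem weak_law_of_large_numbers:
  fixes f :: "'a \<Rightarrow> real"
  assumes \<mu>: "prob_space \<mu>" and f: "integrable \<mu> f" and e: "e > 0"
  shows "(\<lambda>n. measure (prod_pow \<mu> n) {x \<in> space (prod_pow \<mu> n). e \<le> \<bar>emp_avg n f x - (\<integral>x. f x \<partial>\<mu>)\<bar>}) \<longlonglongrightarrow> 0"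
proof -
  let ?bad = "\<lambda>n f e. {x \<in> space (prod_pow \<mu> n). e \<le> \<bar>emp_avg n f x - (\<integral>x. f x \<partial>\<mu>)\<bar>}"
  interpret prob_space \<mu> by fact
  have fm[measurable]: "f \<in> borel_measurable \<mu>" using f by auto
  define g where "g k x = max (- real k) (min (real k) (f x))" for k :: nat and x
  have gm[measurable]: "g k \<in> borel_measurable \<mu>" for k by (simp add: g_def[abs_def])
  have gb: "\<bar>g k x\<bar> \<le> real k" for k x by (auto simp: g_def)
  have ig: "integrable \<mu> (g k)" for k by (rule integrable_bounded_prob[OF \<mu> gm gb])
  have "(\<lambda>k. \<integral>x. \<bar>f x - g k x\<bar> \<partial>\<mu>) \<longlonglongrightarrow> (\<integral>x. 0 \<partial>\<mu>)"
  proof (rule integral_dominated_convergence[where w = "\<lambda>x. \<bar>f x\<bar>"])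
    show "AE x in \<mu>. (\<lambda>k. \<bar>f x - g k x\<bar>) \<longlonglongrightarrow> 0"
    proof (rule AE_I2)
      fix x
      have "\<forall>\<^sub>F k in sequentially. \<bar>f x - g k x\<bar> = 0"
        using eventually_ge_at_top[of "nat \<lceil>\<bar>f x\<bar>\<rceil>"]
      proof eventually_elim
        case (elim k)
        then have "\<bar>f x\<bar> \<le> real k" by linarith
        then show ?case by (auto simp: g_def)
      qed
      then show "(\<lambda>k. \<bar>f x - g k x\<bar>) \<longlonglongrightarrow> 0" by (rule tendsto_eventually)
    qed
    fix k show "AE x in \<mu>. norm \<bar>f x - g k x\<bar> \<le> \<bar>f x\<bar>" by (auto simp: g_def)
  qed (use f in auto)
  then have conv: "(\<lambda>k. \<integral>x. \<bar>f x - g k x\<bar> \<partial>\<mu>) \<longlonglongrightarrow> 0" by simp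
  show ?thesis
  proof (rule tendstoI)
    fix d :: real assume d: "d > 0"
    \<comment> \<open>The bound e/3 handles one of three terms of a triangle inequality; the bound d
      e / 6, divided by the Markov threshold e/3, contributes d/2.\<close>
    have "\<forall>\<^sub>F k in sequentially. (\<integral>x. \<bar>f x - g k x\<bar> \<partial>\<mu>) < min (e / 3) (d * e / 6)"
      by (rule order_tendstoD(2)[OF conv]) (use e d in auto)
    then obtain k where k: "(\<integral>x. \<bar>f x - g k x\<bar> \<partial>\<mu>) < e / 3" "(\<integral>x. \<bar>f x - g k x\<bar> \<partial>\<mu>) < d * e / 6"
      by (auto dest!: eventually_happens)
    define h where "h x = \<bar>f x - g k x\<bar>" for x
    have hm[measurable]: "h \<in> borel_measurable \<mu>" by (simp add: h_def[abs_def])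
    have ih: "integrable \<mu> h" using f ig by (simp add: h_def[abs_def])
    have bound: "measure (prod_pow \<mu> n) (?bad n f e) \<le> (2 * k)\<^sup>2 / (n * (e/3)\<^sup>2) + d / 2" if n: "n \<ge> 1" for n
    proof -
      interpret P: prob_space "prod_pow \<mu> n" by (rule prob_space_prod_pow) fact
      note [measurable] = borel_measurable_emp_avg[OF gm, of n k] borel_measurable_emp_avg[OF hm, of n]
        borel_measurable_emp_avg[OF fm, of n]
      let ?H = "{x \<in> space (prod_pow \<mu> n). e / 3 \<le> emp_avg n h x}"
      have "?bad n f e \<subseteq> ?bad n (g k) (e/3) \<union> ?H"
      proof (rule subsetI, rule ccontr)
        fix x assume x: "x \<in> ?bad n f e" "x \<notin> ?bad n (g k) (e/3) \<union> ?H"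
        then have 1: "\<bar>emp_avg n (g k) x - (\<integral>x. g k x \<partial>\<mu>)\<bar> < e / 3" "emp_avg n h x < e / 3" by auto
        have "\<bar>emp_avg n f x - emp_avg n (g k) x\<bar> = \<bar>\<Sum>i<n. f (x i) - g k (x i)\<bar> / n"
          by (simp add: emp_avg_def sum_subtractf diff_divide_distrib[symmetric])
        also have "\<dots> \<le> emp_avg n h x"
          unfolding emp_avg_def h_def by (intro divide_right_mono sum_abs) auto
        finally have 2: "\<bar>emp_avg n f x - emp_avg n (g k) x\<bar> < e / 3" using 1 by simp
        have "\<bar>(\<integral>x. g k x \<partial>\<mu>) - (\<integral>x. f x \<partial>\<mu>)\<bar> = \<bar>\<integral>x. f x - g k x \<partial>\<mu>\<bar>"
          using f ig by simp
        also have "\<dots> \<le> (\<integral>x. \<bar>f x - g k x\<bar> \<partial>\<mu>)" by (rule integral_abs_bound)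
        finally have "\<bar>(\<integral>x. g k x \<partial>\<mu>) - (\<integral>x. f x \<partial>\<mu>)\<bar> < e / 3" using k by simp
        then have "\<bar>emp_avg n f x - (\<integral>x. f x \<partial>\<mu>)\<bar> < e" using 1 2 by linarith
        then show False using x by auto
      qed
      then have "measure (prod_pow \<mu> n) (?bad n f e) \<le> measure (prod_pow \<mu> n) (?bad n (g k) (e/3) \<union> ?H)"
        by (rule P.finite_measure_mono) measurable
      also have "\<dots> \<le> measure (prod_pow \<mu> n) (?bad n (g k) (e/3)) + measure (prod_pow \<mu> n) ?H"
        by (rule measure_Un_le) measurable
      also have "measure (prod_pow \<mu> n) (?bad n (g k) (e/3)) \<le> (2 * k)\<^sup>2 / (n * (e/3)\<^sup>2)"
        using weak_law_bounded[OF \<mu> gm gb, of "e/3" n k] e n by simp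
      also have "measure (prod_pow \<mu> n) ?H \<le> (\<integral>x. emp_avg n h x \<partial>prod_pow \<mu> n) / (e / 3)"
      proof (rule integral_Markov_inequality_measure[of _ _ "{}"])
        show "integrable (prod_pow \<mu> n) (emp_avg n h)"
          unfolding emp_avg_def[abs_def]
          using integrable_prod_pow_component[OF \<mu> ih]
          by (intro Bochner_Integration.integrable_sum integrable_divide) auto
        show "AE x in prod_pow \<mu> n. 0 \<le> emp_avg n h x"
          by (auto simp: emp_avg_def h_def intro!: divide_nonneg_nonneg sum_nonneg)
      qed (use e in auto)
      also have "(\<integral>x. emp_avg n h x \<partial>prod_pow \<mu> n) = (\<integral>x. h x \<partial>\<mu>)"
        unfolding emp_avg_def
        using integrable_prod_pow_component[OF \<mu> ih] integral_prod_pow_component[OF \<mu> ih] n by simp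
      also have "\<dots> / (e / 3) \<le> d / 2"
        using k(2) e by (simp add: h_def field_simps)
      finally show ?thesis by simp
    qed
    have "(\<lambda>n. (2 * real k)\<^sup>2 / (e/3)\<^sup>2 * (1 / real n)) \<longlonglongrightarrow> (2 * real k)\<^sup>2 / (e/3)\<^sup>2 * 0"
      by (intro tendsto_intros lim_1_over_n)
    then have "\<forall>\<^sub>F n in sequentially. (2 * real k)\<^sup>2 / (e/3)\<^sup>2 * (1 / real n) < d / 2"
      by (rule order_tendstoD(2)) (use d in auto)
    then show "\<forall>\<^sub>F n in sequentially. dist (measure (prod_pow \<mu> n) (?bad n f e)) 0 < d"
      using eventually_ge_at_top[of 1]
    proof eventually_elim
      case (elim n)
      then show ?case using bound[of n] by (simp add: mult.commute)
    qed
  qed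
qed

section \<open>Typical samples and their probability under a change of measure\<close>

text \<open>A neighbourhood of \<mu> among the empirical measures, as seen by the finite test family
  \<open>Fs\<close>.\<close>

definition typical :: "'a measure \<Rightarrow> nat \<Rightarrow> ('a \<Rightarrow> real) set \<Rightarrow> real \<Rightarrow> (nat \<Rightarrow> 'a) set" where
  "typical \<mu> n Fs e = {x \<in> space (prod_pow \<mu> n). \<forall>f\<in>Fs. \<bar>emp_avg n f x - (\<integral>x. f x \<partial>\<mu>)\<bar> < e}"

lemma typical_compl: "typical \<mu> n Fs e
    = space (prod_pow \<mu> n) - (\<Union>f\<in>Fs. {x \<in> space (prod_pow \<mu> n). e \<le> \<bar>emp_avg n f x - (\<integral>x. f x \<partial>\<mu>)\<bar>})"
  by (auto simp: typical_def not_le)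

lemma sets_typical:
  assumes "finite Fs" "\<And>f. f \<in> Fs \<Longrightarrow> f \<in> borel_measurable \<mu>"
  shows "typical \<mu> n Fs e \<in> sets (prod_pow \<mu> n)"
  unfolding typical_compl
proof (intro sets.Diff sets.top sets.finite_UN assms(1))
  fix f assume "f \<in> Fs"
  note [measurable] = borel_measurable_emp_avg[OF assms(2)[OF this], of n]
  show "{x \<in> space (prod_pow \<mu> n). e \<le> \<bar>emp_avg n f x - (\<integral>x. f x \<partial>\<mu>)\<bar>} \<in> sets (prod_pow \<mu> n)"
    by measurable
qed

text \<open>The value 1/2 is the mass that the concentration property asks of a set. A union bound
  over \<open>Fs\<close> reduces the claim to the law of large numbers.\<close>

lemma eventually_typical:
  assumes \<mu>: "prob_space \<mu>" and Fs: "finite Fs" "\<And>f. f \<in> Fs \<Longrightarrow> integrable \<mu> f" and e: "e > 0"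
  shows "\<forall>\<^sub>F n in sequentially. 1/2 \<le> measure (prod_pow \<mu> n) (typical \<mu> n Fs e)"
proof -
  let ?bad = "\<lambda>n f. {x \<in> space (prod_pow \<mu> n). e \<le> \<bar>emp_avg n f x - (\<integral>x. f x \<partial>\<mu>)\<bar>}"
  have "(\<lambda>n. \<Sum>f\<in>Fs. measure (prod_pow \<mu> n) (?bad n f)) \<longlonglongrightarrow> (\<Sum>f\<in>Fs. 0)"
    by (intro tendsto_sum weak_law_of_large_numbers \<mu> Fs e)
  then have "\<forall>\<^sub>F n in sequentially. (\<Sum>f\<in>Fs. measure (prod_pow \<mu> n) (?bad n f)) < 1/2"
    by (rule order_tendstoD(2)) auto
  then show ?thesis
  proof eventually_elim
    case (elim n)
    interpret P: prob_space "prod_pow \<mu> n" by (rule prob_space_prod_pow) fact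
    have m: "?bad n f \<in> sets (prod_pow \<mu> n)" if "f \<in> Fs" for f
    proof -
      note [measurable] = borel_measurable_emp_avg[OF borel_measurable_integrable[OF Fs(2)[OF that]], of n]
      show ?thesis by measurable
    qed
    have "measure (prod_pow \<mu> n) (\<Union>f\<in>Fs. ?bad n f) \<le> (\<Sum>f\<in>Fs. measure (prod_pow \<mu> n) (?bad n f))"
      by (rule measure_UNION_le[OF Fs(1) m])
    moreover have "measure (prod_pow \<mu> n) (typical \<mu> n Fs e) = 1 - measure (prod_pow \<mu> n) (\<Union>f\<in>Fs. ?bad n f)"
      unfolding typical_compl by (rule P.prob_compl) (use m Fs in auto)
    ultimately show ?case using elim by linarith
  qed
qed

text \<open>Boxes determine a finite product measure, and on a box both the density and the
  indicator factor over the coordinates.\<close>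

lemma prod_pow_density:
  fixes h :: "'a \<Rightarrow> ennreal"
  assumes \<mu>: "prob_space \<mu>" and h[measurable]: "h \<in> borel_measurable \<mu>" and \<nu>: "prob_space (density \<mu> h)"
  shows "prod_pow (density \<mu> h) n = density (prod_pow \<mu> n) (\<lambda>x. \<Prod>i<n. h (x i))"
proof -
  interpret M: product_sigma_finite "\<lambda>_::nat. \<mu>"
    using \<mu> by (simp add: product_sigma_finite_def prob_space_imp_sigma_finite)
  interpret N: product_sigma_finite "\<lambda>_::nat. density \<mu> h"
    using \<nu> by (simp add: product_sigma_finite_def prob_space_imp_sigma_finite)
  interpret PN: prob_space "prod_pow (density \<mu> h) n" by (rule prob_space_prod_pow) fact
  let ?I = "{..<n}"
  have hm: "(\<lambda>x. \<Prod>i<n. h (x i)) \<in> borel_measurable (prod_pow \<mu> n)"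
    unfolding prod_pow_def by measurable
  have s: "sets (density (prod_pow \<mu> n) (\<lambda>x. \<Prod>i<n. h (x i))) = sets (PiM ?I (\<lambda>_. density \<mu> h))"
    unfolding prod_pow_def sets_density by (intro sets_PiM_cong) auto
  show ?thesis
  proof (rule measure_eqI_PiM_finite[of ?I _ "\<lambda>_. density \<mu> h" _ "\<lambda>_. PiE ?I (\<lambda>_. space \<mu>)"])
    show "sets (prod_pow (density \<mu> h) n) = sets (PiM ?I (\<lambda>_. density \<mu> h))"
      by (simp add: prod_pow_def)
    show "sets (density (prod_pow \<mu> n) (\<lambda>x. \<Prod>i<n. h (x i))) = sets (PiM ?I (\<lambda>_. density \<mu> h))"
      by (rule s)
    fix A :: "nat \<Rightarrow> 'a set" assume A: "\<And>i. i \<in> ?I \<Longrightarrow> A i \<in> sets (density \<mu> h)"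
    then have [measurable]: "\<And>i. i < n \<Longrightarrow> A i \<in> sets \<mu>" by simp
    have AP: "PiE ?I A \<in> sets (PiM ?I (\<lambda>_. \<mu>))" using A by (intro sets_PiM_I_finite) auto
    have "emeasure (density (prod_pow \<mu> n) (\<lambda>x. \<Prod>i<n. h (x i))) (PiE ?I A)
        = (\<integral>\<^sup>+x. (\<Prod>i<n. h (x i)) * indicator (PiE ?I A) x \<partial>PiM ?I (\<lambda>_. \<mu>))"
      using hm AP unfolding prod_pow_def by (rule emeasure_density)
    also have "\<dots> = (\<integral>\<^sup>+x. (\<Prod>i<n. h (x i) * indicator (A i) (x i)) \<partial>PiM ?I (\<lambda>_. \<mu>))"
    proof (rule nn_integral_cong)
      fix x assume x: "x \<in> space (PiM ?I (\<lambda>_. \<mu>))"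
      have "(\<Prod>i<n. indicator (A i) (x i)) = (indicator (PiE ?I A) x :: ennreal)"
      proof (cases "x \<in> PiE ?I A")
        case False
        then obtain i where "i < n" "x i \<notin> A i" using x by (auto simp: space_PiM PiE_iff)
        then have "(\<Prod>i<n. indicator (A i) (x i)) = (0 :: ennreal)"
          by (intro prod_zero) (auto intro!: bexI[of _ i])
        then show ?thesis using False by simp
      qed (auto simp: PiE_iff intro!: prod.neutral)
      then show "(\<Prod>i<n. h (x i)) * indicator (PiE ?I A) x = (\<Prod>i<n. h (x i) * indicator (A i) (x i))"
        by (simp add: prod.distrib)
    qed
    also have "\<dots> = (\<Prod>i<n. \<integral>\<^sup>+x. h x * indicator (A i) x \<partial>\<mu>)"
      by (rule M.product_nn_integral_prod) auto
    also have "\<dots> = (\<Prod>i<n. emeasure (density \<mu> h) (A i))"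
      by (intro prod.cong refl) (auto simp: emeasure_density)
    also have "\<dots> = emeasure (prod_pow (density \<mu> h) n) (PiE ?I A)"
      unfolding prod_pow_def by (rule N.emeasure_PiM[symmetric]) (use A in auto)
    finally show "emeasure (prod_pow (density \<mu> h) n) (PiE ?I A)
      = emeasure (density (prod_pow \<mu> n) (\<lambda>x. \<Prod>i<n. h (x i))) (PiE ?I A)" by simp
  next
    show "range (\<lambda>_::nat. PiE ?I (\<lambda>_. space \<mu>)) \<subseteq> prod_algebra ?I (\<lambda>_. density \<mu> h)"
      by (auto intro!: prod_algebraI_finite)
    show "(\<Union>i::nat. PiE ?I (\<lambda>_. space \<mu>)) = space (PiM ?I (\<lambda>_. density \<mu> h))"
      by (simp add: space_PiM)
    show "emeasure (prod_pow (density \<mu> h) n) (PiE ?I (\<lambda>_. space \<mu>)) \<noteq> \<infinity>"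
      by simp
  qed simp
qed

text \<open>Since ln h belongs to \<open>Fs\<close>, the product density is at most exp (n (H + e))
  on the typical set, H being the entropy. A set of \<nu>^n-mass at least 1/2 with such a density
  bound cannot be too small for \<mu>^n.\<close>

lemma measure_typical_lower_bound:
  fixes h :: "'a \<Rightarrow> real"
  assumes \<mu>: "prob_space \<mu>" and h: "h \<in> borel_measurable \<mu>" "\<And>x. 0 \<le> h x"
    and \<nu>: "prob_space \<nu>" "\<nu> = density \<mu> h"
    and Fs: "finite Fs" "\<And>f. f \<in> Fs \<Longrightarrow> f \<in> borel_measurable \<mu>" "(\<lambda>x. ln (h x)) \<in> Fs"
    and n: "n \<ge> 1" and half: "1/2 \<le> measure (prod_pow \<nu> n) (typical \<nu> n Fs e)"
  shows "1/2 * exp (- (n * ((\<integral>x. ln (h x) \<partial>\<nu>) + e))) \<le> measure (prod_pow \<mu> n) (typical \<nu> n Fs e)"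
proof -
  define H where "H = (\<integral>x. ln (h x) \<partial>\<nu>)"
  define T where "T = typical \<nu> n Fs e"
  interpret P: prob_space "prod_pow \<mu> n" by (rule prob_space_prod_pow) fact
  interpret Q: prob_space "prod_pow \<nu> n" by (rule prob_space_prod_pow) fact
  have sm: "sets \<nu> = sets \<mu>" by (simp add: \<nu>)
  have spp: "sets (prod_pow \<nu> n) = sets (prod_pow \<mu> n)"
    unfolding prod_pow_def by (intro sets_PiM_cong) (auto simp: sm)
  have "T \<in> sets (prod_pow \<nu> n)"
    unfolding T_def by (rule sets_typical[OF Fs(1)]) (use Fs(2) sm measurable_cong_sets[OF sm refl] in auto)
  then have T[measurable]: "T \<in> sets (prod_pow \<mu> n)" by (simp add: spp)
  have pm: "(\<lambda>x. \<Prod>i<n. ennreal (h (x i))) \<in> borel_measurable (prod_pow \<mu> n)"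
    using borel_measurable_prod_pow_component[OF h(1)]
    by (intro borel_measurable_prod_ennreal measurable_compose[OF _ measurable_ennreal]) auto
  have prod_le: "(\<Prod>i<n. h (x i)) \<le> exp (n * (H + e))" if "x \<in> T" for x
  proof (cases "\<forall>i<n. h (x i) > 0")
    case True
    have "emp_avg n (\<lambda>x. ln (h x)) x < H + e"
      using that Fs(3) by (auto simp: T_def typical_def H_def abs_less_iff)
    then have "(\<Sum>i<n. ln (h (x i))) \<le> n * (H + e)"
      using n by (simp add: emp_avg_def field_simps)
    then have "exp (\<Sum>i<n. ln (h (x i))) \<le> exp (n * (H + e))" by simp
    also have "exp (\<Sum>i<n. ln (h (x i))) = (\<Prod>i<n. h (x i))"
      unfolding exp_sum[OF finite_lessThan] by (intro prod.cong) (use True in auto)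
    finally show ?thesis .
  next
    \<comment> \<open>A vanishing factor enters the average as ln 0 = 0, so the sum of logarithms
      says nothing about the product; but then the product itself is 0.\<close>
    case False
    then obtain i where "i < n" "h (x i) = 0" using h(2) by (metis less_eq_real_def)
    then have "(\<Prod>i<n. h (x i)) = 0" by (intro prod_zero) auto
    then show ?thesis by (simp only: exp_ge_zero)
  qed
  have "emeasure (prod_pow \<nu> n) T = (\<integral>\<^sup>+x. (\<Prod>i<n. ennreal (h (x i))) * indicator T x \<partial>prod_pow \<mu> n)"
    unfolding \<nu>(2) using prod_pow_density[OF \<mu>, of "\<lambda>x. ennreal (h x)" n] h \<nu> pm T
    by (simp add: emeasure_density)
  also have "\<dots> \<le> (\<integral>\<^sup>+x. ennreal (exp (n * (H + e))) * indicator T x \<partial>prod_pow \<mu> n)"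
    by (intro nn_integral_mono) (auto simp: indicator_def prod_ennreal h prod_le intro!: ennreal_leI)
  also have "\<dots> = ennreal (exp (n * (H + e)) * measure (prod_pow \<mu> n) T)"
    by (simp add: nn_integral_cmult_indicator P.emeasure_eq_measure ennreal_mult)
  finally have "measure (prod_pow \<nu> n) T \<le> exp (n * (H + e)) * measure (prod_pow \<mu> n) T"
    by (simp add: Q.emeasure_eq_measure)
  then have "1/2 \<le> exp (n * (H + e)) * measure (prod_pow \<mu> n) T" using half by (simp add: T_def)
  then have "exp (- (n * (H + e))) * (1/2) \<le> exp (- (n * (H + e))) * (exp (n * (H + e)) * measure (prod_pow \<mu> n) T)"
    by (intro mult_left_mono) auto
  also have "\<dots> = measure (prod_pow \<mu> n) T" by (simp add: mult.assoc[symmetric] exp_add[symmetric])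
  finally show ?thesis by (simp add: T_def H_def)
qed

text \<open>Integrate ln u >= 1 - 1/u at u = h: the integral of 1/h under \<nu> is the \<mu>-mass of
  {h > 0}, hence at most 1.\<close>

lemma entropy_nonneg:
  fixes h :: "'a \<Rightarrow> real"
  assumes \<mu>: "prob_space \<mu>" and h[measurable]: "h \<in> borel_measurable \<mu>" and h0: "\<And>x. 0 \<le> h x"
    and \<nu>: "prob_space \<nu>" "\<nu> = density \<mu> h"
    and int: "integrable \<nu> (\<lambda>x. ln (h x))"
  shows "0 \<le> (\<integral>x. ln (h x) \<partial>\<nu>)"
proof -
  interpret prob_space \<mu> by fact
  interpret N: prob_space \<nu> by fact
  \<comment> \<open>As 1 / 0 = 0, this product is the indicator of {h > 0}.\<close>
  have b: "\<bar>h x * (1 / h x)\<bar> \<le> 1" for x by auto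
  have i: "integrable \<mu> (\<lambda>x. h x * (1 / h x))"
    by (rule integrable_bounded_prob[OF \<mu> _ b]) measurable
  then have i': "integrable \<nu> (\<lambda>x. 1 / h x)"
    unfolding \<nu>(2) by (subst integrable_density) (use h0 in \<open>auto simp: field_simps\<close>)
  have "AE x in \<nu>. h x > 0"
    unfolding \<nu>(2) by (subst AE_density) (auto simp: h0)
  then have "AE x in \<nu>. 1 - 1 / h x \<le> ln (h x)"
  proof eventually_elim
    case (elim x)
    then show ?case using ln_le_minus_one[of "1 / h x"] by (simp add: ln_div)
  qed
  then have "(\<integral>x. 1 - 1 / h x \<partial>\<nu>) \<le> (\<integral>x. ln (h x) \<partial>\<nu>)"
    using i' int by (intro integral_mono_AE) auto
  moreover have "(\<integral>x. 1 / h x \<partial>\<nu>) = (\<integral>x. h x * (1 / h x) \<partial>\<mu>)"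
    unfolding \<nu>(2) by (subst integral_density) (auto simp: h0)
  moreover have "\<dots> \<le> 1" using abs_le_D1[OF integral_bound[OF \<mu> b]] .
  ultimately show ?thesis using i' by (simp add: N.prob_space)
qed

lemma outer_measure_le:
  assumes "prob_space M" "B \<in> sets M" "S \<subseteq> B"
  shows "outer_measure M S \<le> measure M B"
  unfolding outer_measure_def
  by (rule cInf_lower) (use assms in \<open>auto intro!: bdd_belowI[of _ 0]\<close>)

text \<open>Here large deviations meet concentration: outside the enlargement of the \<mu>-typical
  samples there is less mass than the \<nu>-typical samples carry. Everything later draws on
  concentration only through the two close samples obtained here.\<close>

lemma concentration_imp_close_samples:
  fixes \<mu> :: "'a::polish_space measure" and h :: "'a \<Rightarrow> real"
  assumes conc: "concentration \<mu> a r\<^sub>o b" and a: "a > 0"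
    and \<mu>: "prob_space \<mu>" and h: "h \<in> borel_measurable \<mu>" "\<And>x. 0 \<le> h x"
    and \<nu>: "prob_space \<nu>" "\<nu> = density \<mu> h"
    and int: "integrable \<nu> (\<lambda>x. ln (h x))"
    and Fs: "finite Fs" "\<And>f. f \<in> Fs \<Longrightarrow> integrable \<mu> f" "\<And>f. f \<in> Fs \<Longrightarrow> integrable \<nu> f"
    and e: "e > 0"
  shows "\<exists>n x y. n \<ge> 1 \<and> (\<forall>f\<in>Fs. \<bar>emp_avg n f y - (\<integral>x. f x \<partial>\<nu>)\<bar> < e)
    \<and> (\<forall>f\<in>Fs. \<bar>emp_avg n f x - (\<integral>x. f x \<partial>\<mu>)\<bar> < e)
    \<and> (\<Sum>i<n. (dist (y i) (x i))\<^sup>2) / n \<le> (\<integral>x. ln (h x) \<partial>\<nu>) / a + e"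
proof -
  define H where "H = (\<integral>x. ln (h x) \<partial>\<nu>)"
  have H: "0 \<le> H" unfolding H_def by (rule entropy_nonneg) fact+
  \<comment> \<open>The part a e / 4 makes the loss 2 e' / a at most e/2, which leaves room for the
    vanishing influence of \<open>r\<^sub>o\<close>.\<close>
  define e' where "e' = min e (a * e / 4)"
  have e': "0 < e'" "e' \<le> e" using a e by (auto simp: e'_def)
  have "2 * e' / a \<le> e / 2" using a by (auto simp: e'_def field_simps min_def)
  then have e'2: "(H + 2 * e') / a < H / a + e" using e by (simp add: add_divide_distrib)
  \<comment> \<open>The squared radius per coordinate. In a c = H + 2 e' one e' pays for the
    tolerance in the lower bound exp (- n (H + e')), the other one beats the factor
    \<open>b\<close>.\<close>
  define c where "c = (H + 2 * e') / a"
  have c0: "c > 0" using H e' a by (simp add: c_def)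
  define r where "r n = r\<^sub>o + sqrt (n * c)" for n :: nat
  \<comment> \<open>The logarithm of the density is tested under \<nu> only, where it is integrable;
    it is what the lower bound for the mass of the typical set requires.\<close>
  let ?Gs = "insert (\<lambda>x. ln (h x)) Fs"
  have ev1: "\<forall>\<^sub>F n in sequentially. 1/2 \<le> measure (prod_pow \<mu> n) (typical \<mu> n Fs e)"
    by (rule eventually_typical) fact+
  have ev2: "\<forall>\<^sub>F n in sequentially. 1/2 \<le> measure (prod_pow \<nu> n) (typical \<nu> n ?Gs e')"
    by (rule eventually_typical) (use \<nu> Fs int e' in auto)
  have ev3: "\<forall>\<^sub>F n in sequentially. b * exp (- (real n * e')) < 1/2"
  proof -
    have "(\<lambda>n. b * exp (- (real n * e'))) \<longlonglongrightarrow> b * 0"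
    proof (intro tendsto_intros filterlim_compose[OF exp_at_bot])
      show "LIM n sequentially. - (real n * e') :> at_bot"
        using filterlim_tendsto_pos_mult_at_top[OF tendsto_const[of e'] e'(1) filterlim_real_sequentially]
        by (simp add: filterlim_uminus_at_bot mult.commute)
    qed
    then show ?thesis by (intro order_tendstoD(2)[of _ 0]) auto
  qed
  have ev4: "\<forall>\<^sub>F n in sequentially. (r\<^sub>o / sqrt n + sqrt c)\<^sup>2 < H / a + e"
  proof -
    have "filterlim (\<lambda>n. sqrt (real n)) at_top sequentially"
      by (rule filterlim_compose[OF sqrt_at_top filterlim_real_sequentially])
    then have "(\<lambda>n. r\<^sub>o / sqrt (real n)) \<longlonglongrightarrow> 0"
      by (intro real_tendsto_divide_at_top[OF tendsto_const])
    then have "(\<lambda>n. (r\<^sub>o / sqrt (real n) + sqrt c)\<^sup>2) \<longlonglongrightarrow> (0 + sqrt c)\<^sup>2"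
      by (intro tendsto_intros)
    then show ?thesis by (rule order_tendstoD(2)) (use c0 e'2 in \<open>auto simp: c_def\<close>)
  qed
  have "\<forall>\<^sub>F n in sequentially. n \<ge> 1 \<and> 1/2 \<le> measure (prod_pow \<mu> n) (typical \<mu> n Fs e)
    \<and> 1/2 \<le> measure (prod_pow \<nu> n) (typical \<nu> n ?Gs e') \<and> b * exp (- (real n * e')) < 1/2
    \<and> (r\<^sub>o / sqrt n + sqrt c)\<^sup>2 < H / a + e"
    by (intro eventually_conj ev1 ev2 ev3 ev4 eventually_ge_at_top)
  then obtain n where n: "n \<ge> 1" "1/2 \<le> measure (prod_pow \<mu> n) (typical \<mu> n Fs e)"
    "1/2 \<le> measure (prod_pow \<nu> n) (typical \<nu> n ?Gs e')" "b * exp (- (real n * e')) < 1/2"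
    "(r\<^sub>o / sqrt n + sqrt c)\<^sup>2 < H / a + e"
    by (auto dest!: eventually_happens)
  have pn: "prob_space (prod_pow \<mu> n)" by (rule prob_space_prod_pow) fact
  interpret P: prob_space "prod_pow \<mu> n" by (rule pn)
  define A where "A = typical \<mu> n Fs e"
  define T where "T = typical \<nu> n ?Gs e'"
  have A: "A \<in> sets (prod_pow \<mu> n)" unfolding A_def by (rule sets_typical) (use Fs in auto)
  have sm: "sets \<nu> = sets \<mu>" by (simp add: \<nu>)
  have spp: "sets (prod_pow \<nu> n) = sets (prod_pow \<mu> n)"
    unfolding prod_pow_def by (intro sets_PiM_cong) (auto simp: sm)
  have "T \<in> sets (prod_pow \<nu> n)" unfolding T_def by (rule sets_typical) (use Fs int in auto)
  then have T: "T \<in> sets (prod_pow \<mu> n)" by (simp add: spp)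
  have low: "1/2 * exp (- (n * (H + e'))) \<le> measure (prod_pow \<mu> n) T"
    unfolding T_def H_def
    by (rule measure_typical_lower_bound[OF \<mu> h \<nu> _ _ _ n(1,3)]) (use Fs h in auto)
  have rr: "r n - r\<^sub>o = sqrt (n * c)" "r n \<ge> r\<^sub>o" using c0 by (auto simp: r_def)
  have "1 - b * exp (- a * (r n - r\<^sub>o)\<^sup>2) \<le> outer_measure (prod_pow \<mu> n) (enlarge \<mu> n A (r n))"
    using conc n(1) A n(2) rr(2) unfolding concentration_def A_def by blast
  moreover have "- a * (r n - r\<^sub>o)\<^sup>2 = - (n * (H + e')) + - (n * e')"
  proof -
    have "a * (r n - r\<^sub>o)\<^sup>2 = n * (a * c)" using c0 by (simp add: rr)
    also have "a * c = H + 2 * e'" using a by (simp add: c_def)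
    finally show ?thesis by (simp add: algebra_simps)
  qed
  ultimately have out: "1 - b * exp (- (n * e')) * exp (- (n * (H + e')))
      \<le> outer_measure (prod_pow \<mu> n) (enlarge \<mu> n A (r n))"
    by (simp only: exp_add mult.assoc mult.commute mult.left_commute)
  \<comment> \<open>Disjointness would put the outer measure below 1 - \<mu>^n(T). After cancelling
    exp (- n (H + e')) this contradicts b exp (- n e') < 1/2.\<close>
  have "enlarge \<mu> n A (r n) \<inter> T \<noteq> {}"
  proof
    assume "enlarge \<mu> n A (r n) \<inter> T = {}"
    then have "enlarge \<mu> n A (r n) \<subseteq> space (prod_pow \<mu> n) - T" by (auto simp: enlarge_def)
    then have "outer_measure (prod_pow \<mu> n) (enlarge \<mu> n A (r n)) \<le> 1 - measure (prod_pow \<mu> n) T"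
      using outer_measure_le[OF pn] T P.prob_compl[OF T] by (metis sets.compl_sets)
    then have "1/2 * exp (- (n * (H + e'))) \<le> b * exp (- (n * e')) * exp (- (n * (H + e')))"
      using out low by linarith
    then show False using n(4) by simp
  qed
  then obtain y x where yx: "y \<in> T" "x \<in> A" "rho2 n y x \<le> r n" by (auto simp: enlarge_def)
  have "(\<Sum>i<n. (dist (y i) (x i))\<^sup>2) \<le> (r n)\<^sup>2"
    unfolding rho2_sq[symmetric] by (rule power_mono[OF yx(3) rho2_nonneg])
  then have "(\<Sum>i<n. (dist (y i) (x i))\<^sup>2) / n \<le> (r n)\<^sup>2 / n" by (rule divide_right_mono) simp
  also have "\<dots> = (r\<^sub>o / sqrt n + sqrt c)\<^sup>2"
  proof -
    have "r\<^sub>o / sqrt n + sqrt c = r n / sqrt n"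
      using n(1) by (simp add: r_def real_sqrt_mult add_divide_distrib)
    then show ?thesis by (simp add: power_divide)
  qed
  also have "\<dots> \<le> H / a + e" using n(5) by simp
  finally have cost: "(\<Sum>i<n. (dist (y i) (x i))\<^sup>2) / n \<le> H / a + e" .
  show ?thesis
  proof (rule exI[of _ n], rule exI[of _ x], rule exI[of _ y], intro conjI ballI n(1) cost[unfolded H_def])
    fix f assume f: "f \<in> Fs"
    show "\<bar>emp_avg n f y - (\<integral>x. f x \<partial>\<nu>)\<bar> < e" using yx(1) f e' by (force simp: T_def typical_def)
    show "\<bar>emp_avg n f x - (\<integral>x. f x \<partial>\<mu>)\<bar> < e" using yx(2) f by (auto simp: A_def typical_def)
  qed
qed

section \<open>From concentration to the transport inequality\<close>

text \<open>Bolzano-Weierstrass in a cube, one coordinate at a time. The indices will be pairs of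
  cells, so a finite partition replaces tightness arguments for couplings.\<close>

lemma finite_index_convergent_subseq:
  fixes p :: "nat \<Rightarrow> 'i \<Rightarrow> real"
  assumes "finite I" "\<And>k i. i \<in> I \<Longrightarrow> p k i \<in> {0..1}"
  shows "\<exists>r l. strict_mono (r :: nat \<Rightarrow> nat) \<and> (\<forall>i\<in>I. (\<lambda>k. p (r k) i) \<longlonglongrightarrow> l i)"
  using assms
proof (induction I rule: finite_induct)
  case empty
  show ?case by (intro exI[of _ id]) (auto simp: strict_mono_def)
next
  case (insert j I)
  have "\<exists>r l. strict_mono (r :: nat \<Rightarrow> nat) \<and> (\<forall>i\<in>I. (\<lambda>k. p (r k) i) \<longlonglongrightarrow> l i)"
    by (rule insert.IH) (use insert.prems in blast)
  then obtain r l where r: "strict_mono (r :: nat \<Rightarrow> nat)" "\<And>i. i \<in> I \<Longrightarrow> (\<lambda>k. p (r k) i) \<longlonglongrightarrow> l i"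
    by blast
  have "\<forall>k. p (r k) j \<in> {0..1}" using insert.prems by auto
  then obtain l' s where s: "strict_mono (s :: nat \<Rightarrow> nat)" "((\<lambda>k. p (r k) j) \<circ> s) \<longlonglongrightarrow> l'"
    using seq_compactE[OF compact_imp_seq_compact[OF compact_Icc, of 0 "1::real"], of "\<lambda>k. p (r k) j"] by metis
  have "(\<lambda>k. p ((r \<circ> s) k) i) \<longlonglongrightarrow> (l(j := l')) i" if "i \<in> insert j I" for i
  proof (cases "i = j")
    case True
    then show ?thesis using s(2) by (simp add: o_def)
  next
    case False
    then have "i \<in> I" using that by auto
    from LIMSEQ_subseq_LIMSEQ[OF r(2)[OF this] s(1)] show ?thesis using False by (simp add: o_def)
  qed
  then show ?case using strict_mono_o[OF r(1) s(1)] by blast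
qed

lemma nn_integral_finite_range:
  fixes F :: "'b \<Rightarrow> ennreal"
  assumes T: "finite (range T)" "\<And>s. T -` {s} \<in> sets borel" and M: "sets M = sets borel"
  shows "(\<integral>\<^sup>+x. F (T x) \<partial>M) = (\<Sum>s\<in>range T. F s * emeasure M (T -` {s}))"
proof -
  have "F (T x) = (\<Sum>s\<in>range T. F s * indicator (T -` {s}) x)" for x
    using T(1) by (simp add: indicator_def if_distrib[of "(*) _"] cong: if_cong)
  then have "(\<integral>\<^sup>+x. F (T x) \<partial>M) = (\<integral>\<^sup>+x. (\<Sum>s\<in>range T. F s * indicator (T -` {s}) x) \<partial>M)" by simp
  also have "\<dots> = (\<Sum>s\<in>range T. \<integral>\<^sup>+x. F s * indicator (T -` {s}) x \<partial>M)"
    by (rule nn_integral_sum) (use T M in auto)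
  also have "\<dots> = (\<Sum>s\<in>range T. F s * emeasure M (T -` {s}))"
    by (intro sum.cong nn_integral_cmult_indicator refl) (use T M in auto)
  finally show ?thesis .
qed

text \<open>A matrix with the right marginals on the cells of a finite partition becomes a coupling
  if, given the cells, the two points are drawn independently.\<close>
lemma coupling_from_cells:
  fixes \<nu> \<mu> :: "'a::metric_space measure" and T :: "'a \<Rightarrow> 'b" and p :: "'b \<Rightarrow> 'b \<Rightarrow> real"
  assumes \<nu>: "prob_space \<nu>" "sets \<nu> = sets borel" and \<mu>: "prob_space \<mu>" "sets \<mu> = sets borel"
    and T: "finite (range T)" "\<And>s. T -` {s} \<in> sets borel"
    and p0: "\<And>s t. 0 \<le> p s t"
    and row: "\<And>s. s \<in> range T \<Longrightarrow> (\<Sum>t\<in>range T. p s t) = measure \<nu> (T -` {s})"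
    and col: "\<And>t. t \<in> range T \<Longrightarrow> (\<Sum>s\<in>range T. p s t) = measure \<mu> (T -` {t})"
  obtains \<pi> where "\<pi> \<in> couplings \<nu> \<mu>"
    "\<And>F :: 'b \<Rightarrow> 'b \<Rightarrow> real. (\<And>s t. 0 \<le> F s t) \<Longrightarrow>
      (\<integral>\<^sup>+w. ennreal (F (T (fst w)) (T (snd w))) \<partial>\<pi>) = ennreal (\<Sum>s\<in>range T. \<Sum>t\<in>range T. p s t * F s t)"
proof -
  interpret N: prob_space \<nu> by fact
  interpret M: prob_space \<mu> by fact
  interpret NM: pair_sigma_finite \<nu> \<mu>
    by (simp add: pair_sigma_finite_def N.sigma_finite_measure_axioms M.sigma_finite_measure_axioms)
  let ?S = "range T"
  define u v where "u s = measure \<nu> (T -` {s})" and "v t = measure \<mu> (T -` {t})" for s t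
  \<comment> \<open>The density of the coupling with respect to the product of \<nu> and \<mu>:
    constant on each pair of cells, which is conditional independence given the cells.\<close>
  define q where "q s t = ennreal (p s t / (u s * v t))" for s t
  have p_le_u: "p s t \<le> u s" and p_le_v: "p s t \<le> v t" if "s \<in> ?S" "t \<in> ?S" for s t
    using member_le_sum[of t ?S "\<lambda>t. p s t"] member_le_sum[of s ?S "\<lambda>s. p s t"] that T(1) p0 row[of s] col[of t]
    by (auto simp: u_def v_def)
  have uv0: "0 \<le> u s" "0 \<le> v s" for s by (auto simp: u_def v_def)
  \<comment> \<open>If a cell is null, the quotient is 0 by convention; the marginal conditions
    force the entry of p to vanish there too, so no mass is lost.\<close>
  have p_q: "q s t * (ennreal (u s) * ennreal (v t)) = ennreal (p s t)" if "s \<in> ?S" "t \<in> ?S" for s t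
  proof -
    have "p s t / (u s * v t) * (u s * v t) = p s t"
      using p_le_u[OF that] p_le_v[OF that] p0[of s t] by (cases "u s * v t = 0") auto
    then show ?thesis
      unfolding q_def using uv0 p0 by (simp add: ennreal_mult[symmetric])
  qed
  have eu: "emeasure \<nu> (T -` {s}) = ennreal (u s)" and ev: "emeasure \<mu> (T -` {s}) = ennreal (v s)" for s
    by (auto simp: u_def v_def N.emeasure_eq_measure M.emeasure_eq_measure)
  have Tm: "T \<in> measurable borel (count_space ?S)"
    by (rule measurable_count_space_eq_countable[THEN iffD2])
      (use T in \<open>auto intro: countable_finite\<close>)
  have sp: "sets (\<nu> \<Otimes>\<^sub>M \<mu>) = sets (borel \<Otimes>\<^sub>M borel)"
    by (rule sets_pair_measure_cong) fact+
  have Fm: "(\<lambda>w. G (T (fst w)) (T (snd w))) \<in> borel_measurable (\<nu> \<Otimes>\<^sub>M \<mu>)" for G :: "'b \<Rightarrow> 'b \<Rightarrow> ennreal"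
  proof -
    have TT: "(\<lambda>w. (T (fst w), T (snd w))) \<in> measurable (borel \<Otimes>\<^sub>M borel) (count_space ?S \<Otimes>\<^sub>M count_space ?S)"
      by (intro measurable_Pair measurable_compose[OF measurable_fst Tm] measurable_compose[OF measurable_snd Tm])
    have "(\<lambda>z. G (fst z) (snd z)) \<in> borel_measurable (count_space ?S \<Otimes>\<^sub>M count_space ?S)"
      using T(1) by (simp add: pair_measure_count_space)
    from measurable_compose[OF TT this]
    have "(\<lambda>w. G (T (fst w)) (T (snd w))) \<in> borel_measurable (borel \<Otimes>\<^sub>M borel)" by simp
    then show ?thesis using measurable_cong_sets[OF sp refl] by blast
  qed
  define \<pi> where "\<pi> = density (\<nu> \<Otimes>\<^sub>M \<mu>) (\<lambda>w. q (T (fst w)) (T (snd w)))"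
  have sets_\<pi>: "sets \<pi> = sets (borel \<Otimes>\<^sub>M borel)" by (simp add: \<pi>_def sp)
  have space_\<pi>: "space \<pi> = UNIV" using sets_eq_imp_space_eq[OF sets_\<pi>] by (simp add: space_pair_measure)
  have w_row: "(\<integral>\<^sup>+y. q s (T y) \<partial>\<mu>) * ennreal (u s) = ennreal (u s)" if s: "s \<in> ?S" for s
  proof -
    have "(\<integral>\<^sup>+y. q s (T y) \<partial>\<mu>) * ennreal (u s) = (\<Sum>t\<in>?S. q s t * (ennreal (u s) * ennreal (v t)))"
      unfolding nn_integral_finite_range[OF T \<mu>(2)] ev by (simp add: sum_distrib_left ac_simps)
    also have "\<dots> = (\<Sum>t\<in>?S. ennreal (p s t))" using p_q s by simp
    also have "\<dots> = ennreal (u s)" using row[OF s] p0 by (simp add: sum_ennreal u_def)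
    finally show ?thesis .
  qed
  have w_col: "(\<integral>\<^sup>+x. q (T x) t \<partial>\<nu>) * ennreal (v t) = ennreal (v t)" if t: "t \<in> ?S" for t
  proof -
    have "(\<integral>\<^sup>+x. q (T x) t \<partial>\<nu>) * ennreal (v t) = (\<Sum>s\<in>?S. q s t * (ennreal (u s) * ennreal (v t)))"
      unfolding nn_integral_finite_range[OF T \<nu>(2), of "\<lambda>s. q s t"] eu by (simp add: sum_distrib_left ac_simps)
    also have "\<dots> = (\<Sum>s\<in>?S. ennreal (p s t))" using p_q t by simp
    also have "\<dots> = ennreal (v t)" using col[OF t] p0 by (simp add: sum_ennreal v_def)
    finally show ?thesis .
  qed
  \<comment> \<open>The row and column identities carry the mass of a cell as a factor and can be
    cancelled only where it is positive. Finitely many null cells form a null set.\<close>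
  have null: "AE x in M'. measure M' (T -` {T x}) > 0"
    if M': "prob_space M'" "sets M' = sets borel" for M' :: "'a measure"
  proof -
    interpret M': prob_space M' by fact
    have "AE x in M'. \<forall>s\<in>{s\<in>?S. measure M' (T -` {s}) = 0}. x \<notin> T -` {s}"
    proof (rule AE_finite_allI)
      fix s assume "s \<in> {s\<in>?S. measure M' (T -` {s}) = 0}"
      then have "T -` {s} \<in> null_sets M'"
        using T M' by (auto simp: null_sets_def M'.emeasure_eq_measure)
      then show "AE x in M'. x \<notin> T -` {s}" by (rule AE_not_in)
    qed (use T in auto)
    then show ?thesis
    proof eventually_elim
      case (elim x)
      then show ?case by (metis (mono_tags, lifting) measure_nonneg mem_Collect_eq order_le_less rangeI vimageI singletonI)
    qed
  qed
  have one: "w = 1" if "w * ennreal c = ennreal c" "c > 0" for w c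
  proof -
    have "ennreal c * w = ennreal c * 1" using that by (simp add: mult.commute)
    then show ?thesis using that(2) by (subst (asm) ennreal_mult_cancel_left) auto
  qed
  have row1: "AE x in \<nu>. (\<integral>\<^sup>+y. q (T x) (T y) \<partial>\<mu>) = 1"
    using null[OF \<nu>]
  proof eventually_elim
    case (elim x)
    show ?case by (rule one[OF w_row]) (use elim in \<open>auto simp: u_def\<close>)
  qed
  have col1: "AE y in \<mu>. (\<integral>\<^sup>+x. q (T x) (T y) \<partial>\<nu>) = 1"
    using null[OF \<mu>]
  proof eventually_elim
    case (elim y)
    show ?case by (rule one[OF w_col]) (use elim in \<open>auto simp: v_def\<close>)
  qed
  have mfst: "fst \<in> measurable \<pi> borel" and msnd: "snd \<in> measurable \<pi> borel"
    using measurable_fst measurable_snd measurable_cong_sets[OF sets_\<pi> refl] by blast+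
  have Tq1: "(\<lambda>y. q s (T y)) \<in> borel_measurable \<mu>" "(\<lambda>x. q (T x) s) \<in> borel_measurable \<nu>" for s
    using measurable_compose[OF Tm, of "q s" borel] measurable_compose[OF Tm, of "\<lambda>x. q x s" borel]
      measurable_cong_sets[OF \<mu>(2) refl] measurable_cong_sets[OF \<nu>(2) refl] by auto
  have d1: "distr \<pi> borel fst = \<nu>"
  proof (rule measure_eqI)
    show "sets (distr \<pi> borel fst) = sets \<nu>" using \<nu> by simp
    fix E assume "E \<in> sets (distr \<pi> borel fst)"
    then have E: "E \<in> sets borel" "E \<in> sets \<nu>" using \<nu> by auto
    have Ep: "fst -` E \<in> sets (\<nu> \<Otimes>\<^sub>M \<mu>)"
      using measurable_sets[OF mfst E(1)] by (simp add: space_\<pi> sets_\<pi> sp)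
    have "emeasure (distr \<pi> borel fst) E = emeasure \<pi> (fst -` E)"
      using E by (simp add: emeasure_distr[OF mfst] space_\<pi>)
    also have "\<dots> = (\<integral>\<^sup>+w. q (T (fst w)) (T (snd w)) * indicator (fst -` E) w \<partial>(\<nu> \<Otimes>\<^sub>M \<mu>))"
      unfolding \<pi>_def using Fm Ep by (rule emeasure_density)
    also have "\<dots> = (\<integral>\<^sup>+x. \<integral>\<^sup>+y. q (T x) (T y) * indicator E x \<partial>\<mu> \<partial>\<nu>)"
      using M.nn_integral_fst[OF borel_measurable_times_ennreal[OF Fm[of q] borel_measurable_indicator[OF Ep]]]
      by (simp add: indicator_def)
    also have "\<dots> = (\<integral>\<^sup>+x. (\<integral>\<^sup>+y. q (T x) (T y) \<partial>\<mu>) * indicator E x \<partial>\<nu>)"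
      by (intro nn_integral_cong nn_integral_multc Tq1)
    also have "\<dots> = (\<integral>\<^sup>+x. indicator E x \<partial>\<nu>)"
      by (rule nn_integral_cong_AE) (use row1 in auto)
    also have "\<dots> = emeasure \<nu> E" using E by simp
    finally show "emeasure (distr \<pi> borel fst) E = emeasure \<nu> E" .
  qed
  have d2: "distr \<pi> borel snd = \<mu>"
  proof (rule measure_eqI)
    show "sets (distr \<pi> borel snd) = sets \<mu>" using \<mu> by simp
    fix E assume "E \<in> sets (distr \<pi> borel snd)"
    then have E: "E \<in> sets borel" "E \<in> sets \<mu>" using \<mu> by auto
    have Ep: "snd -` E \<in> sets (\<nu> \<Otimes>\<^sub>M \<mu>)"
      using measurable_sets[OF msnd E(1)] by (simp add: space_\<pi> sets_\<pi> sp)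
    have "emeasure (distr \<pi> borel snd) E = emeasure \<pi> (snd -` E)"
      using E by (simp add: emeasure_distr[OF msnd] space_\<pi>)
    also have "\<dots> = (\<integral>\<^sup>+w. q (T (fst w)) (T (snd w)) * indicator (snd -` E) w \<partial>(\<nu> \<Otimes>\<^sub>M \<mu>))"
      unfolding \<pi>_def using Fm Ep by (rule emeasure_density)
    also have "\<dots> = (\<integral>\<^sup>+y. \<integral>\<^sup>+x. q (T x) (T y) * indicator E y \<partial>\<nu> \<partial>\<mu>)"
      using NM.nn_integral_snd[OF borel_measurable_times_ennreal[OF Fm[of q] borel_measurable_indicator[OF Ep]]]
      by (simp add: indicator_def)
    also have "\<dots> = (\<integral>\<^sup>+y. (\<integral>\<^sup>+x. q (T x) (T y) \<partial>\<nu>) * indicator E y \<partial>\<mu>)"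
      by (intro nn_integral_cong nn_integral_multc Tq1)
    also have "\<dots> = (\<integral>\<^sup>+y. indicator E y \<partial>\<mu>)"
      by (rule nn_integral_cong_AE) (use col1 in auto)
    also have "\<dots> = emeasure \<mu> E" using E by simp
    finally show "emeasure (distr \<pi> borel snd) E = emeasure \<mu> E" .
  qed
  have "prob_space (distr \<pi> borel fst)" using d1 \<nu> by simp
  then have "prob_space \<pi>" using mfst by (rule prob_space_distrD[rotated])
  then have "\<pi> \<in> couplings \<nu> \<mu>" using sets_\<pi> d1 d2 by (simp add: couplings_def)
  moreover have "(\<integral>\<^sup>+w. ennreal (F (T (fst w)) (T (snd w))) \<partial>\<pi>)
      = ennreal (\<Sum>s\<in>?S. \<Sum>t\<in>?S. p s t * F s t)" if F: "\<And>s t. 0 \<le> F s t" for F :: "'b \<Rightarrow> 'b \<Rightarrow> real"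
  proof -
    have "(\<integral>\<^sup>+w. ennreal (F (T (fst w)) (T (snd w))) \<partial>\<pi>)
        = (\<integral>\<^sup>+w. q (T (fst w)) (T (snd w)) * ennreal (F (T (fst w)) (T (snd w))) \<partial>(\<nu> \<Otimes>\<^sub>M \<mu>))"
      unfolding \<pi>_def by (rule nn_integral_density) (rule Fm)+
    also have "\<dots> = (\<integral>\<^sup>+x. \<integral>\<^sup>+y. q (T x) (T y) * ennreal (F (T x) (T y)) \<partial>\<mu> \<partial>\<nu>)"
      using M.nn_integral_fst[OF Fm[of "\<lambda>s t. q s t * ennreal (F s t)"]] by simp
    also have "\<dots> = (\<Sum>s\<in>?S. (\<Sum>t\<in>?S. q s t * ennreal (F s t) * ennreal (v t)) * ennreal (u s))"
      unfolding nn_integral_finite_range[OF T \<mu>(2), of "\<lambda>t. q (T x) t * ennreal (F (T x) t)" for x] ev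
      unfolding nn_integral_finite_range[OF T \<nu>(2), of "\<lambda>s. (\<Sum>t\<in>?S. q s t * ennreal (F s t) * ennreal (v t))"] eu ..
    also have "\<dots> = (\<Sum>s\<in>?S. \<Sum>t\<in>?S. ennreal (p s t * F s t))"
      unfolding sum_distrib_right
    proof (intro sum.cong refl)
      fix s t assume st: "s \<in> ?S" "t \<in> ?S"
      have "q s t * ennreal (F s t) * ennreal (v t) * ennreal (u s) = q s t * (ennreal (u s) * ennreal (v t)) * ennreal (F s t)"
        by (simp add: ac_simps)
      then show "q s t * ennreal (F s t) * ennreal (v t) * ennreal (u s) = ennreal (p s t * F s t)"
        using p_q[OF st] p0 F by (simp add: ennreal_mult)
    qed
    also have "\<dots> = ennreal (\<Sum>s\<in>?S. \<Sum>t\<in>?S. p s t * F s t)"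
      using p0 F by (simp add: sum_ennreal sum_nonneg)
    finally show ?thesis .
  qed
  ultimately show thesis by (rule that)
qed

text \<open>Rearrange (t u - v)^2 / t >= 0. The weight keeps the coefficient of the main term close
  to 1, at the price of 1/t on the error term.\<close>

lemma square_sum_le_weighted:
  fixes u v :: real
  assumes "t > 0"
  shows "(u + v)\<^sup>2 \<le> (1 + t) * u\<^sup>2 + (1 + 1 / t) * v\<^sup>2"
proof -
  have "0 \<le> (t * u - v)\<^sup>2 / t" using assms by simp
  also have "\<dots> = t * u\<^sup>2 - 2 * u * v + v\<^sup>2 / t"
    using assms by (simp add: power2_diff field_simps power2_eq_square)
  finally show ?thesis by (simp add: power2_sum algebra_simps)
qed

text \<open>Moving both end points costs a factor 1 + t on the squared distance, which disappears as
  t tends to 0, plus the squared displacements.\<close>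

lemma dist_square_le_weighted:
  fixes x y x' y' :: "'a::metric_space"
  assumes t: "t > 0"
  shows "(dist x y)\<^sup>2 \<le> (1 + t) * (dist x' y')\<^sup>2 + 2 * (1 + 1 / t) * ((dist x x')\<^sup>2 + (dist y y')\<^sup>2)"
proof -
  have "dist x y \<le> dist x' y' + (dist x x' + dist y y')"
    using dist_triangle[of x y x'] dist_triangle[of x' y y'] by (simp add: dist_commute)
  then have "(dist x y)\<^sup>2 \<le> (dist x' y' + (dist x x' + dist y y'))\<^sup>2" by (intro power_mono) auto
  also have "\<dots> \<le> (1 + t) * (dist x' y')\<^sup>2 + (1 + 1 / t) * (dist x x' + dist y y')\<^sup>2"
    by (rule square_sum_le_weighted[OF t])
  also have "(dist x x' + dist y y')\<^sup>2 \<le> 2 * ((dist x x')\<^sup>2 + (dist y y')\<^sup>2)"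
    using square_sum_le_weighted[of 1 "dist x x'" "dist y y'"] by simp
  then have "(1 + 1 / t) * (dist x x' + dist y y')\<^sup>2 \<le> (1 + 1 / t) * (2 * ((dist x x')\<^sup>2 + (dist y y')\<^sup>2))"
    using t by (intro mult_left_mono) auto
  finally show ?thesis by (simp add: algebra_simps)
qed

lemma integrable_nn_integral_finite:
  fixes f :: "'a \<Rightarrow> real"
  assumes "f \<in> borel_measurable M" "\<And>x. 0 \<le> f x" "(\<integral>\<^sup>+x. ennreal (f x) \<partial>M) < \<infinity>"
  shows "integrable M f"
  using assms by (intro integrableI_bounded) auto

section \<open>A fixed \<nu> of finite entropy under the concentration hypothesis\<close>

context
  fixes \<mu> \<nu> :: "'a::polish_space measure" and h :: "'a \<Rightarrow> real" and a r\<^sub>o b :: real and o\<^sub>x :: 'a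
  assumes conc: "concentration \<mu> a r\<^sub>o b" and a: "a > 0"
    and \<mu>: "prob_space \<mu>" and s\<mu>: "sets \<mu> = sets borel"
    and h: "h \<in> borel_measurable \<mu>" "\<And>x. 0 \<le> h x"
    and \<nu>: "prob_space \<nu>" "\<nu> = density \<mu> h"
    and int: "integrable \<nu> (\<lambda>x. ln (h x))"
    and moment: "(\<integral>\<^sup>+ x. ennreal ((dist o\<^sub>x x)\<^sup>2) \<partial>\<mu>) < \<infinity>"
begin

lemmas close_samples = concentration_imp_close_samples[OF conc a \<mu> h \<nu> int]

lemma sets_nu: "sets \<nu> = sets borel"
  by (simp add: \<nu>(2) s\<mu>)

lemma borel_measurable_mu_nu:
  assumes "f \<in> borel_measurable borel"
  shows "f \<in> borel_measurable \<mu>" "f \<in> borel_measurable \<nu>"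
  using assms measurable_cong_sets[OF s\<mu> refl] measurable_cong_sets[OF sets_nu refl] by blast+

lemma second_moment_mu: "integrable \<mu> (\<lambda>x. (dist o\<^sub>x x)\<^sup>2)"
  by (rule integrable_nn_integral_finite[OF _ _ moment])
    (auto intro!: borel_measurable_mu_nu)

text \<open>The squared distance is not yet an admissible test function, as its \<nu>-integrability
  is the claim. Its truncations are admissible, and \<nu>-typical samples lie near \<mu>-typical
  ones, so the truncated moments are bounded uniformly in R.\<close>

lemma second_moment_nu: "integrable \<nu> (\<lambda>x. (dist o\<^sub>x x)\<^sup>2)"
proof -
  define f where "f R x = min ((dist o\<^sub>x x)\<^sup>2) (real R)" for R :: nat and x
  define H where "H = (\<integral>x. ln (h x) \<partial>\<nu>)"
  \<comment> \<open>Samples with tolerance 1: the summands 1 are the tolerances of the two averages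
    and of the cost, and each factor 2 comes from (u + v)^2 <= 2 u^2 + 2 v^2.\<close>
  define K where "K = 1 + 2 * ((\<integral>x. (dist o\<^sub>x x)\<^sup>2 \<partial>\<mu>) + 1) + 2 * (H / a + 1)"
  have fm: "f R \<in> borel_measurable borel" for R unfolding f_def[abs_def] by measurable
  have fb: "\<bar>f R x\<bar> \<le> real R" for R x by (auto simp: f_def)
  have i: "integrable \<mu> (f R)" "integrable \<nu> (f R)" for R
    using integrable_bounded_prob[OF \<mu> borel_measurable_mu_nu(1)[OF fm] fb]
      integrable_bounded_prob[OF \<nu>(1) borel_measurable_mu_nu(2)[OF fm] fb] by auto
  have bound: "(\<integral>x. f R x \<partial>\<nu>) \<le> K" for R
  proof -
    have "\<exists>n x y. n \<ge> 1 \<and> (\<forall>g\<in>{f R}. \<bar>emp_avg n g y - (\<integral>x. g x \<partial>\<nu>)\<bar> < 1)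
      \<and> (\<forall>g\<in>{f R}. \<bar>emp_avg n g x - (\<integral>x. g x \<partial>\<mu>)\<bar> < 1)
      \<and> (\<Sum>i<n. (dist (y i) (x i))\<^sup>2) / n \<le> H / a + 1"
      unfolding H_def by (rule close_samples) (use i in auto)
    then obtain n x y where y: "\<bar>emp_avg n (f R) y - (\<integral>x. f R x \<partial>\<nu>)\<bar> < 1"
      and x: "\<bar>emp_avg n (f R) x - (\<integral>x. f R x \<partial>\<mu>)\<bar> < 1"
      and c: "(\<Sum>i<n. (dist (y i) (x i))\<^sup>2) / n \<le> H / a + 1"
      by blast
    have "f R u \<le> 2 * f R v + 2 * (dist u v)\<^sup>2" for u v
    proof -
      have "(dist o\<^sub>x u)\<^sup>2 \<le> (dist o\<^sub>x v + dist u v)\<^sup>2"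
        using dist_triangle[of o\<^sub>x u v] by (intro power_mono) (auto simp: dist_commute)
      also have "\<dots> \<le> 2 * (dist o\<^sub>x v)\<^sup>2 + 2 * (dist u v)\<^sup>2"
        using square_sum_le_weighted[of 1 "dist o\<^sub>x v" "dist u v"] by simp
      finally have "(dist o\<^sub>x u)\<^sup>2 \<le> 2 * (dist o\<^sub>x v)\<^sup>2 + 2 * (dist u v)\<^sup>2" .
      then show ?thesis
        using zero_le_power2[of "dist u v"] of_nat_0_le_iff[of R, where ?'a = real]
        unfolding f_def by linarith
    qed
    then have "(\<Sum>i<n. f R (y i)) \<le> (\<Sum>i<n. 2 * f R (x i) + 2 * (dist (y i) (x i))\<^sup>2)"
      by (intro sum_mono) auto
    then have "emp_avg n (f R) y \<le> (\<Sum>i<n. 2 * f R (x i) + 2 * (dist (y i) (x i))\<^sup>2) / n"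
      unfolding emp_avg_def by (rule divide_right_mono) simp
    also have "\<dots> = 2 * emp_avg n (f R) x + 2 * ((\<Sum>i<n. (dist (y i) (x i))\<^sup>2) / n)"
      by (simp add: emp_avg_def sum.distrib sum_distrib_left[symmetric] add_divide_distrib)
    finally have "emp_avg n (f R) y \<le> 2 * emp_avg n (f R) x + 2 * (H / a + 1)"
      using c by simp
    then have "(\<integral>x. f R x \<partial>\<nu>) \<le> 1 + 2 * ((\<integral>x. f R x \<partial>\<mu>) + 1) + 2 * (H / a + 1)"
      using abs_less_iff[THEN iffD1, OF x] abs_less_iff[THEN iffD1, OF y] by argo
    moreover have "(\<integral>x. f R x \<partial>\<mu>) \<le> (\<integral>x. (dist o\<^sub>x x)\<^sup>2 \<partial>\<mu>)"
      by (rule integral_mono[OF i(1) second_moment_mu]) (simp add: f_def)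
    ultimately show ?thesis unfolding K_def by argo
  qed
  have sup: "(SUP R. ennreal (f R x)) = ennreal ((dist o\<^sub>x x)\<^sup>2)" for x
  proof (rule antisym)
    show "(SUP R. ennreal (f R x)) \<le> ennreal ((dist o\<^sub>x x)\<^sup>2)"
      by (intro SUP_least ennreal_leI) (simp add: f_def)
    have "ennreal ((dist o\<^sub>x x)\<^sup>2) = ennreal (f (nat \<lceil>(dist o\<^sub>x x)\<^sup>2\<rceil>) x)"
      by (simp add: f_def min_def)
    also have "\<dots> \<le> (SUP R. ennreal (f R x))" by (rule SUP_upper) simp
    finally show "ennreal ((dist o\<^sub>x x)\<^sup>2) \<le> (SUP R. ennreal (f R x))" .
  qed
  have "(\<integral>\<^sup>+x. ennreal ((dist o\<^sub>x x)\<^sup>2) \<partial>\<nu>) = (SUP R. \<integral>\<^sup>+x. ennreal (f R x) \<partial>\<nu>)"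
    unfolding sup[symmetric]
  proof (rule nn_integral_monotone_convergence_SUP)
    show "incseq (\<lambda>R x. ennreal (f R x))"
      by (auto simp: incseq_def le_fun_def f_def intro!: ennreal_leI)
    show "(\<lambda>x. ennreal (f R x)) \<in> borel_measurable \<nu>" for R
      using borel_measurable_mu_nu(2)[OF fm] by measurable
  qed
  also have "\<dots> \<le> ennreal K"
  proof (rule SUP_least)
    fix R
    have "(\<integral>\<^sup>+x. ennreal (f R x) \<partial>\<nu>) = ennreal (\<integral>x. f R x \<partial>\<nu>)"
      by (rule nn_integral_eq_integral[OF i(2)]) (auto simp: f_def)
    then show "(\<integral>\<^sup>+x. ennreal (f R x) \<partial>\<nu>) \<le> ennreal K" using bound by (simp add: ennreal_leI)
  qed
  finally have "(\<integral>\<^sup>+x. ennreal ((dist o\<^sub>x x)\<^sup>2) \<partial>\<nu>) < \<infinity>" by (rule le_less_trans) simp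
  then show ?thesis by (intro integrable_nn_integral_finite) (auto intro!: borel_measurable_mu_nu)
qed

text \<open>Simple functions converging pointwise to the identity, with distance to the base point
  at most doubled, admit dominated convergence under both measures. Finitely many cells thus suffice
  although the space need not be compact.\<close>

lemma finite_range_approximation:
  assumes "\<delta> > 0"
  obtains T :: "'a \<Rightarrow> 'a" where "finite (range T)" "\<And>s. T -` {s} \<in> sets borel"
    "integrable \<mu> (\<lambda>x. (dist x (T x))\<^sup>2)" "integrable \<nu> (\<lambda>x. (dist x (T x))\<^sup>2)"
    "(\<integral>x. (dist x (T x))\<^sup>2 \<partial>\<mu>) < \<delta>" "(\<integral>x. (dist x (T x))\<^sup>2 \<partial>\<nu>) < \<delta>"
proof -
  obtain F :: "nat \<Rightarrow> 'a \<Rightarrow> 'a" where sF: "\<And>i. simple_function borel (F i)"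
    and lim: "\<And>x. (\<lambda>i. F i x) \<longlonglongrightarrow> x" and le: "\<And>i x. dist (F i x) o\<^sub>x \<le> 2 * dist x o\<^sub>x"
    using borel_measurable_implies_sequence_metric[of "\<lambda>x::'a. x" borel o\<^sub>x] by auto
  have Fm: "F i \<in> borel_measurable borel" for i by (rule borel_measurable_simple_function[OF sF])
  define e where "e i x = (dist x (F i x))\<^sup>2" for i x
  have em: "e i \<in> borel_measurable borel" for i using Fm[of i] unfolding e_def[abs_def] by measurable
  \<comment> \<open>The 9 is (1 + 2)^2, by the triangle inequality through the base point.\<close>
  have e_le: "e i x \<le> 9 * (dist o\<^sub>x x)\<^sup>2" for i x
  proof -
    have "dist x (F i x) \<le> 3 * dist o\<^sub>x x"
      using dist_triangle[of x "F i x" o\<^sub>x] le[of i x] by (simp add: dist_commute)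
    then have "e i x \<le> (3 * dist o\<^sub>x x)\<^sup>2" unfolding e_def by (intro power_mono) auto
    then show ?thesis by (simp add: power_mult_distrib)
  qed
  have e0: "(\<lambda>i. e i x) \<longlonglongrightarrow> 0" for x
  proof -
    have "(\<lambda>i. (dist x (F i x))\<^sup>2) \<longlonglongrightarrow> (dist x x)\<^sup>2"
      by (intro tendsto_intros lim)
    then show ?thesis by (simp add: e_def)
  qed
  have *: "(\<forall>i. integrable M (e i)) \<and> (\<lambda>i. \<integral>x. e i x \<partial>M) \<longlonglongrightarrow> 0"
    if M: "sets M = sets borel" "integrable M (\<lambda>x. (dist o\<^sub>x x)\<^sup>2)" for M
  proof -
    have m: "e i \<in> borel_measurable M" for i using em measurable_cong_sets[OF M(1) refl] by blast
    have w: "integrable M (\<lambda>x. 9 * (dist o\<^sub>x x)\<^sup>2)" using M by auto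
    have b: "norm (e i x) \<le> 9 * (dist o\<^sub>x x)\<^sup>2" for i x using e_le by (simp add: e_def)
    have "(\<lambda>i. \<integral>x. e i x \<partial>M) \<longlonglongrightarrow> (\<integral>x. 0 \<partial>M)"
      by (rule integral_dominated_convergence[OF _ m w]) (use e0 b in auto)
    moreover have "integrable M (e i)" for i
      by (rule Bochner_Integration.integrable_bound[OF w m]) (use b[of i] in auto)
    ultimately show ?thesis by simp
  qed
  note m = *[OF s\<mu> second_moment_mu] and n = *[OF sets_nu second_moment_nu]
  have "\<forall>\<^sub>F i in sequentially. (\<integral>x. e i x \<partial>\<mu>) < \<delta> \<and> (\<integral>x. e i x \<partial>\<nu>) < \<delta>"
    using m n assms by (intro eventually_conj order_tendstoD(2)) auto
  then obtain i where i: "(\<integral>x. e i x \<partial>\<mu>) < \<delta>" "(\<integral>x. e i x \<partial>\<nu>) < \<delta>"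
    by (auto dest!: eventually_happens)
  show thesis
  proof (rule that[of "F i"])
    show "finite (range (F i))" using simple_functionD(1)[OF sF[of i]] by simp
    show "F i -` {s} \<in> sets borel" for s using simple_functionD(2)[OF sF[of i], of "{s}"] by simp
  qed (use i m n in \<open>auto simp: e_def[abs_def]\<close>)
qed

text \<open>Points are moved twice: the samples to the representatives of their cells, and these to
  the points of the coupling. Each move costs a factor 1 + t and an error 2 (1 + 1/t) W, where W <=
  2 \<delta>; the first error is multiplied once more by 1 + t, whence the factor 2 + t.\<close>

lemma transport_cost2_le_approx:
  assumes t: "t > 0" and \<delta>: "\<delta> > 0"
  shows "transport_cost2 \<nu> \<mu>
    \<le> ennreal ((1 + t)\<^sup>2 * ((\<integral>x. ln (h x) \<partial>\<nu>) / a) + 4 * (1 + 1 / t) * (2 + t) * \<delta>)"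
proof -
  define H where "H = (\<integral>x. ln (h x) \<partial>\<nu>)"
  interpret M: prob_space \<mu> by (rule \<mu>)
  interpret N: prob_space \<nu> by (rule \<nu>)
  obtain T :: "'a \<Rightarrow> 'a" where T: "finite (range T)" "\<And>s. T -` {s} \<in> sets borel"
    and ie: "integrable \<mu> (\<lambda>x. (dist x (T x))\<^sup>2)" "integrable \<nu> (\<lambda>x. (dist x (T x))\<^sup>2)"
    and e\<delta>: "(\<integral>x. (dist x (T x))\<^sup>2 \<partial>\<mu>) < \<delta>" "(\<integral>x. (dist x (T x))\<^sup>2 \<partial>\<nu>) < \<delta>"
    by (rule finite_range_approximation[OF \<delta>]) auto
  define e where "e x = (dist x (T x))\<^sup>2" for x
  define c where "c s x = (indicator (T -` {s}) x :: real)" for s x :: 'a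
  let ?S = "range T"
  \<comment> \<open>The function \<open>e\<close> controls the discretization error along the
    samples, the indicators the marginals of the limiting joint masses.\<close>
  define Fs where "Fs = insert e (c ` ?S)"
  have ic: "integrable M' (c s)" "(\<integral>x. c s x \<partial>M') = measure M' (T -` {s})"
    if "prob_space M'" "sets M' = sets borel" for M' s
  proof -
    interpret prob_space M' by fact
    show "integrable M' (c s)" "(\<integral>x. c s x \<partial>M') = measure M' (T -` {s})"
      unfolding c_def[abs_def] using T(2) that sets_eq_imp_space_eq[OF that(2)]
      by (auto simp: emeasure_eq_measure)
  qed
  have Fs: "finite Fs" "\<And>f. f \<in> Fs \<Longrightarrow> integrable \<mu> f" "\<And>f. f \<in> Fs \<Longrightarrow> integrable \<nu> f"
    using T ie ic(1)[OF \<mu> s\<mu>] ic(1)[OF \<nu>(1) sets_nu] by (auto simp: Fs_def e_def[abs_def])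
  have csum: "(\<Sum>s\<in>?S. c s x * g s) = g (T x)" for x and g :: "'a \<Rightarrow> real"
    using T(1) by (simp add: c_def indicator_def if_distribR cong: if_cong)
  define Q where "Q k n x y \<longleftrightarrow> n \<ge> 1 \<and> (\<forall>f\<in>Fs. \<bar>emp_avg n f y - (\<integral>x. f x \<partial>\<nu>)\<bar> < 1 / Suc k)
    \<and> (\<forall>f\<in>Fs. \<bar>emp_avg n f x - (\<integral>x. f x \<partial>\<mu>)\<bar> < 1 / Suc k)
    \<and> (\<Sum>i<n. (dist (y i) (x i))\<^sup>2) / n \<le> H / a + 1 / Suc k" for k n :: nat and x y
  have "\<exists>n x y. Q k n x y" for k
    unfolding Q_def H_def
  proof (rule close_samples[OF Fs])
    show "0 < 1 / real (Suc k)" by simp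
  qed
  then obtain n x y where Q: "\<And>k. Q k (n k) (x k) (y k)" by metis
  have n: "n k \<ge> 1"
    and y: "\<And>f. f \<in> Fs \<Longrightarrow> \<bar>emp_avg (n k) f (y k) - (\<integral>x. f x \<partial>\<nu>)\<bar> < 1 / Suc k"
    and x: "\<And>f. f \<in> Fs \<Longrightarrow> \<bar>emp_avg (n k) f (x k) - (\<integral>x. f x \<partial>\<mu>)\<bar> < 1 / Suc k"
    and cost: "(\<Sum>i<n k. (dist (y k i) (x k i))\<^sup>2) / n k \<le> H / a + 1 / Suc k" for k
    using Q[of k] unfolding Q_def by auto
  have inv0: "(\<lambda>k. 1 / real (Suc k)) \<longlonglongrightarrow> 0" using LIMSEQ_Suc[OF lim_1_over_n] by simp
  have limy: "(\<lambda>k. emp_avg (n k) f (y k)) \<longlonglongrightarrow> (\<integral>x. f x \<partial>\<nu>)" if "f \<in> Fs" for f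
    by (rule LIM_zero_cancel, rule Lim_null_comparison[OF _ inv0])
      (use y[OF that] in \<open>auto intro!: always_eventually less_imp_le\<close>)
  have limx: "(\<lambda>k. emp_avg (n k) f (x k)) \<longlonglongrightarrow> (\<integral>x. f x \<partial>\<mu>)" if "f \<in> Fs" for f
    by (rule LIM_zero_cancel, rule Lim_null_comparison[OF _ inv0])
      (use x[OF that] in \<open>auto intro!: always_eventually less_imp_le\<close>)
  \<comment> \<open>The proportion of indices at which y lies in cell s and x in cell t: the
    empirical coupling of the two samples, read on cells.\<close>
  define p where "p k s t = (\<Sum>i<n k. c s (y k i) * c t (x k i)) / n k" for k s t
  have p_g: "(\<Sum>s\<in>?S. \<Sum>t\<in>?S. p k s t * g s t) = (\<Sum>i<n k. g (T (y k i)) (T (x k i))) / n k"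
    for k and g :: "'a \<Rightarrow> 'a \<Rightarrow> real"
  proof -
    have "(\<Sum>s\<in>?S. \<Sum>t\<in>?S. p k s t * g s t)
        = (\<Sum>s\<in>?S. \<Sum>t\<in>?S. \<Sum>i<n k. c s (y k i) * (c t (x k i) * g s t)) / n k"
      by (simp add: p_def sum_distrib_right sum_divide_distrib mult.assoc)
    also have "(\<Sum>s\<in>?S. \<Sum>t\<in>?S. \<Sum>i<n k. c s (y k i) * (c t (x k i) * g s t))
        = (\<Sum>s\<in>?S. \<Sum>i<n k. \<Sum>t\<in>?S. c s (y k i) * (c t (x k i) * g s t))"
      by (intro sum.cong refl sum.swap)
    also have "\<dots> = (\<Sum>i<n k. \<Sum>s\<in>?S. \<Sum>t\<in>?S. c s (y k i) * (c t (x k i) * g s t))"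
      by (rule sum.swap)
    also have "\<dots> = (\<Sum>i<n k. g (T (y k i)) (T (x k i)))"
      by (simp add: sum_distrib_left[symmetric] csum csum[of _ "\<lambda>s. g s (T _)"])
    finally show ?thesis .
  qed
  have csum1: "(\<Sum>s\<in>?S. c s z) = 1" for z using csum[of z "\<lambda>_. 1"] by simp
  have p_row: "(\<Sum>t\<in>?S. p k s t) = emp_avg (n k) (c s) (y k)" for k s
    unfolding p_def emp_avg_def sum_divide_distrib[symmetric]
    by (subst sum.swap) (simp add: sum_distrib_left[symmetric] csum1)
  have p_col: "(\<Sum>s\<in>?S. p k s t) = emp_avg (n k) (c t) (x k)" for k t
    unfolding p_def emp_avg_def sum_divide_distrib[symmetric]
    by (subst sum.swap) (simp add: sum_distrib_right[symmetric] csum1)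
  have p01: "p k s t \<in> {0..1}" for k s t
  proof -
    have c01: "0 \<le> c s z" "c s z \<le> 1" for s z by (auto simp: c_def indicator_def)
    have "(\<Sum>i<n k. c s (y k i) * c t (x k i)) \<le> (\<Sum>i<n k. 1)"
      using c01 by (intro sum_mono mult_le_one) auto
    then show ?thesis using c01 n[of k] unfolding p_def by (auto intro!: divide_nonneg_nonneg sum_nonneg simp: divide_le_eq_1)
  qed
  obtain r l where r: "strict_mono (r :: nat \<Rightarrow> nat)"
    and l': "\<forall>st\<in>?S \<times> ?S. (\<lambda>k. p (r k) (fst st) (snd st)) \<longlonglongrightarrow> l st"
    using finite_index_convergent_subseq[of "?S \<times> ?S" "\<lambda>k st. p k (fst st) (snd st)"] T(1) p01 by auto
  have l: "(\<lambda>k. p (r k) s t) \<longlonglongrightarrow> l (s, t)" if "s \<in> ?S" "t \<in> ?S" for s t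
    using l' that by force
  \<comment> \<open>The limits are controlled only for pairs of cells; the value 0 elsewhere secures
    nonnegativity at all arguments.\<close>
  define q where "q s t = (if s \<in> ?S \<and> t \<in> ?S then l (s, t) else 0)" for s t
  have q: "(\<lambda>k. p (r k) s t) \<longlonglongrightarrow> q s t" if "s \<in> ?S" "t \<in> ?S" for s t
    using l[OF that] that by (simp add: q_def)
  have q0: "0 \<le> q s t" for s t
  proof (cases "s \<in> ?S \<and> t \<in> ?S")
    case True
    then show ?thesis using p01 by (intro LIMSEQ_le_const[OF q]) (auto intro!: exI[of _ 0])
  qed (auto simp: q_def)
  \<comment> \<open>For finite k the marginals are only empirical frequencies of cells; in the limit
    they become the exact masses that a coupling requires.\<close>
  have row: "(\<Sum>t\<in>?S. q s t) = measure \<nu> (T -` {s})" if s: "s \<in> ?S" for s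
  proof (rule LIMSEQ_unique)
    show "(\<lambda>k. \<Sum>t\<in>?S. p (r k) s t) \<longlonglongrightarrow> (\<Sum>t\<in>?S. q s t)"
      by (intro tendsto_sum q s)
    have "c s \<in> Fs" using s by (simp add: Fs_def)
    from LIMSEQ_subseq_LIMSEQ[OF limy[OF this] r]
    show "(\<lambda>k. \<Sum>t\<in>?S. p (r k) s t) \<longlonglongrightarrow> measure \<nu> (T -` {s})"
      unfolding p_row ic(2)[OF \<nu>(1) sets_nu] by (simp add: o_def)
  qed
  have col: "(\<Sum>s\<in>?S. q s t) = measure \<mu> (T -` {t})" if t: "t \<in> ?S" for t
  proof (rule LIMSEQ_unique)
    show "(\<lambda>k. \<Sum>s\<in>?S. p (r k) s t) \<longlonglongrightarrow> (\<Sum>s\<in>?S. q s t)"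
      by (intro tendsto_sum q t)
    have "c t \<in> Fs" using t by (simp add: Fs_def)
    from LIMSEQ_subseq_LIMSEQ[OF limx[OF this] r]
    show "(\<lambda>k. \<Sum>s\<in>?S. p (r k) s t) \<longlonglongrightarrow> measure \<mu> (T -` {t})"
      unfolding p_col ic(2)[OF \<mu> s\<mu>] by (simp add: o_def)
  qed
  define W where "W = (\<integral>x. e x \<partial>\<nu>) + (\<integral>x. e x \<partial>\<mu>)"
  have W: "W \<le> 2 * \<delta>" using e\<delta> by (simp add: W_def e_def)
  \<comment> \<open>The first of the two moves: the cost of the samples, at most H / a in the limit,
    bounds the cost between representatives. The averages of \<open>e\<close> converge to W since
    \<open>e\<close> is a test function.\<close>
  have qcost: "(\<Sum>s\<in>?S. \<Sum>t\<in>?S. q s t * (dist s t)\<^sup>2) \<le> (1 + t) * (H / a) + 2 * (1 + 1 / t) * W"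
  proof (rule LIMSEQ_le)
    show "(\<lambda>k. \<Sum>s\<in>?S. \<Sum>t\<in>?S. p (r k) s t * (dist s t)\<^sup>2) \<longlonglongrightarrow> (\<Sum>s\<in>?S. \<Sum>t\<in>?S. q s t * (dist s t)\<^sup>2)"
      by (intro tendsto_sum tendsto_mult q tendsto_const)
    let ?R = "\<lambda>k. (1 + t) * (H / a + 1 / Suc k) + 2 * (1 + 1 / t) * (emp_avg (n k) e (y k) + emp_avg (n k) e (x k))"
    have "?R \<longlonglongrightarrow> (1 + t) * (H / a + 0) + 2 * (1 + 1 / t) * W"
      unfolding W_def by (intro tendsto_intros inv0 limy limx) (auto simp: Fs_def)
    from LIMSEQ_subseq_LIMSEQ[OF this r]
    show "(\<lambda>k. ?R (r k)) \<longlonglongrightarrow> (1 + t) * (H / a) + 2 * (1 + 1 / t) * W" by (simp add: o_def)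
    have "(\<Sum>s\<in>?S. \<Sum>t\<in>?S. p k s t * (dist s t)\<^sup>2) \<le> ?R k" for k
    proof -
      have "(\<Sum>s\<in>?S. \<Sum>t\<in>?S. p k s t * (dist s t)\<^sup>2) = (\<Sum>i<n k. (dist (T (y k i)) (T (x k i)))\<^sup>2) / n k"
        by (rule p_g)
      also have "\<dots> \<le> (\<Sum>i<n k. (1 + t) * (dist (y k i) (x k i))\<^sup>2 + 2 * (1 + 1 / t) * (e (y k i) + e (x k i))) / n k"
      proof (intro divide_right_mono sum_mono)
        fix i
        show "(dist (T (y k i)) (T (x k i)))\<^sup>2
            \<le> (1 + t) * (dist (y k i) (x k i))\<^sup>2 + 2 * (1 + 1 / t) * (e (y k i) + e (x k i))"
          using dist_square_le_weighted[OF t, of "T (y k i)" "T (x k i)" "y k i" "x k i"]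
          by (simp only: e_def dist_commute[of "T (y k i)" "y k i"] dist_commute[of "T (x k i)" "x k i"])
      qed simp
      also have "\<dots> = (1 + t) * ((\<Sum>i<n k. (dist (y k i) (x k i))\<^sup>2) / n k)
          + 2 * (1 + 1 / t) * (emp_avg (n k) e (y k) + emp_avg (n k) e (x k))"
        unfolding emp_avg_def sum.distrib sum_distrib_left[symmetric]
        by (simp only: add_divide_distrib times_divide_eq_right distrib_left)
      also have "\<dots> \<le> ?R k" using cost[of k] t by (intro add_right_mono mult_left_mono) auto
      finally show ?thesis .
    qed
    then show "\<exists>N. \<forall>k\<ge>N. (\<Sum>s\<in>?S. \<Sum>t\<in>?S. p (r k) s t * (dist s t)\<^sup>2) \<le> ?R (r k)" by blast
  qed
  obtain \<pi> where \<pi>: "\<pi> \<in> couplings \<nu> \<mu>"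
    and \<pi>F: "\<And>F :: 'a \<Rightarrow> 'a \<Rightarrow> real. (\<And>s t. 0 \<le> F s t) \<Longrightarrow>
      (\<integral>\<^sup>+w. ennreal (F (T (fst w)) (T (snd w))) \<partial>\<pi>) = ennreal (\<Sum>s\<in>?S. \<Sum>t\<in>?S. q s t * F s t)"
    using coupling_from_cells[OF \<nu>(1) sets_nu \<mu> s\<mu> T q0 row col] by blast
  have \<pi>s: "sets \<pi> = sets (borel \<Otimes>\<^sub>M borel)"
    and d: "distr \<pi> borel fst = \<nu>" "distr \<pi> borel snd = \<mu>"
    using \<pi> by (auto simp: couplings_def)
  have mfst: "fst \<in> measurable \<pi> borel" and msnd: "snd \<in> measurable \<pi> borel"
    using measurable_fst measurable_snd measurable_cong_sets[OF \<pi>s refl] by blast+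
  have Tm: "T \<in> measurable borel (borel :: 'a measure)"
    by (rule borel_measurable_simple_function) (use T in \<open>auto simp: simple_function_def\<close>)
  have em: "e \<in> borel_measurable borel" unfolding e_def[abs_def] using Tm by measurable
  have eI: "(\<integral>\<^sup>+w. ennreal (e (fst w)) \<partial>\<pi>) = ennreal (\<integral>x. e x \<partial>\<nu>)"
    "(\<integral>\<^sup>+w. ennreal (e (snd w)) \<partial>\<pi>) = ennreal (\<integral>x. e x \<partial>\<mu>)"
  proof -
    have "(\<integral>\<^sup>+w. ennreal (e (fst w)) \<partial>\<pi>) = (\<integral>\<^sup>+x. ennreal (e x) \<partial>\<nu>)"
      unfolding d(1)[symmetric] using em by (subst nn_integral_distr[OF mfst]) auto
    also have "\<dots> = ennreal (\<integral>x. e x \<partial>\<nu>)"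
      by (rule nn_integral_eq_integral) (use ie in \<open>auto simp: e_def[abs_def]\<close>)
    finally show "(\<integral>\<^sup>+w. ennreal (e (fst w)) \<partial>\<pi>) = ennreal (\<integral>x. e x \<partial>\<nu>)" .
    have "(\<integral>\<^sup>+w. ennreal (e (snd w)) \<partial>\<pi>) = (\<integral>\<^sup>+x. ennreal (e x) \<partial>\<mu>)"
      unfolding d(2)[symmetric] using em by (subst nn_integral_distr[OF msnd]) auto
    also have "\<dots> = ennreal (\<integral>x. e x \<partial>\<mu>)"
      by (rule nn_integral_eq_integral) (use ie in \<open>auto simp: e_def[abs_def]\<close>)
    finally show "(\<integral>\<^sup>+w. ennreal (e (snd w)) \<partial>\<pi>) = ennreal (\<integral>x. e x \<partial>\<mu>)" .
  qed
  have e0: "0 \<le> e z" for z by (simp add: e_def)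
  have K0: "0 \<le> 1 + t" "0 \<le> 2 * (1 + 1 / t)" using t by auto
  have mm: "(\<lambda>w. e (fst w)) \<in> borel_measurable \<pi>" "(\<lambda>w. e (snd w)) \<in> borel_measurable \<pi>"
    "(\<lambda>w. (dist (T (fst w)) (T (snd w)))\<^sup>2) \<in> borel_measurable \<pi>"
    using measurable_compose[OF mfst em] measurable_compose[OF msnd em]
      measurable_compose[OF mfst Tm] measurable_compose[OF msnd Tm]
    by (auto intro!: borel_measurable_power borel_measurable_dist)
  \<comment> \<open>The second move, now under the coupling: the displacement errors depend on one
    point each, so their integrals are given by the marginals.\<close>
  have "transport_cost2 \<nu> \<mu> \<le> (\<integral>\<^sup>+ w. ennreal ((dist (fst w) (snd w))\<^sup>2) \<partial>\<pi>)"
    unfolding transport_cost2_def by (rule INF_lower[OF \<pi>])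
  also have "\<dots> \<le> (\<integral>\<^sup>+ w. ennreal (1 + t) * ennreal ((dist (T (fst w)) (T (snd w)))\<^sup>2)
      + ennreal (2 * (1 + 1 / t)) * (ennreal (e (fst w)) + ennreal (e (snd w))) \<partial>\<pi>)"
  proof (rule nn_integral_mono)
    fix w
    have "ennreal ((dist (fst w) (snd w))\<^sup>2) \<le> ennreal ((1 + t) * (dist (T (fst w)) (T (snd w)))\<^sup>2
      + 2 * (1 + 1 / t) * (e (fst w) + e (snd w)))"
      using dist_square_le_weighted[OF t, of "fst w" "snd w" "T (fst w)" "T (snd w)"]
      by (intro ennreal_leI) (simp add: e_def)
    also have "\<dots> = ennreal (1 + t) * ennreal ((dist (T (fst w)) (T (snd w)))\<^sup>2)
      + ennreal (2 * (1 + 1 / t)) * (ennreal (e (fst w)) + ennreal (e (snd w)))"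
      using K0 e0 by (simp only: ennreal_plus ennreal_mult mult_nonneg_nonneg add_nonneg_nonneg zero_le_power2)
    finally show "ennreal ((dist (fst w) (snd w))\<^sup>2) \<le> ennreal (1 + t) * ennreal ((dist (T (fst w)) (T (snd w)))\<^sup>2)
      + ennreal (2 * (1 + 1 / t)) * (ennreal (e (fst w)) + ennreal (e (snd w)))" .
  qed
  also have "\<dots> = ennreal (1 + t) * (\<integral>\<^sup>+ w. ennreal ((dist (T (fst w)) (T (snd w)))\<^sup>2) \<partial>\<pi>)
      + ennreal (2 * (1 + 1 / t)) * ((\<integral>\<^sup>+ w. ennreal (e (fst w)) \<partial>\<pi>) + (\<integral>\<^sup>+ w. ennreal (e (snd w)) \<partial>\<pi>))"
    using mm by (simp add: nn_integral_add nn_integral_cmult)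
  also have "\<dots> = ennreal (1 + t) * ennreal (\<Sum>s\<in>?S. \<Sum>t\<in>?S. q s t * (dist s t)\<^sup>2)
      + ennreal (2 * (1 + 1 / t)) * (ennreal (\<integral>x. e x \<partial>\<nu>) + ennreal (\<integral>x. e x \<partial>\<mu>))"
    unfolding eI by (subst \<pi>F[of "\<lambda>s t. (dist s t)\<^sup>2"]) auto
  also have "\<dots> = ennreal ((1 + t) * (\<Sum>s\<in>?S. \<Sum>t\<in>?S. q s t * (dist s t)\<^sup>2) + 2 * (1 + 1 / t) * W)"
  proof -
    have "0 \<le> (\<Sum>s\<in>?S. \<Sum>t\<in>?S. q s t * (dist s t)\<^sup>2)" using q0 by (intro sum_nonneg) auto
    moreover have "0 \<le> (\<integral>x. e x \<partial>\<nu>)" "0 \<le> (\<integral>x. e x \<partial>\<mu>)" using e0 by (auto intro!: integral_nonneg_AE)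
    ultimately show ?thesis
      unfolding W_def using K0 by (simp only: ennreal_plus ennreal_mult mult_nonneg_nonneg add_nonneg_nonneg)
  qed
  also have "\<dots> \<le> ennreal ((1 + t)\<^sup>2 * (H / a) + 4 * (1 + 1 / t) * (2 + t) * \<delta>)"
  proof (rule ennreal_leI)
    have "(1 + t) * (\<Sum>s\<in>?S. \<Sum>t\<in>?S. q s t * (dist s t)\<^sup>2) + 2 * (1 + 1 / t) * W
      \<le> (1 + t) * ((1 + t) * (H / a) + 2 * (1 + 1 / t) * W) + 2 * (1 + 1 / t) * W"
      using qcost K0 by (intro add_right_mono mult_left_mono) auto
    also have "\<dots> = (1 + t)\<^sup>2 * (H / a) + 2 * (1 + 1 / t) * (2 + t) * W"
    proof -
      have "(1 + t) * ((1 + t) * K + 2 * C * W) + 2 * C * W = (1 + t)\<^sup>2 * K + 2 * C * (2 + t) * W" for K C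
        by (simp add: power2_eq_square algebra_simps)
      then show ?thesis .
    qed
    also have "2 * (1 + 1 / t) * (2 + t) * W \<le> 2 * (1 + 1 / t) * (2 + t) * (2 * \<delta>)"
      using W t by (intro mult_left_mono) auto
    also have "2 * (1 + 1 / t) * (2 + t) * (2 * \<delta>) = 4 * (1 + 1 / t) * (2 + t) * \<delta>"
    proof -
      have "2 * C * (2 + t) * (2 * \<delta>) = 4 * C * (2 + t) * \<delta>" for C by simp
      then show ?thesis .
    qed
    finally show "(1 + t) * (\<Sum>s\<in>?S. \<Sum>t\<in>?S. q s t * (dist s t)\<^sup>2) + 2 * (1 + 1 / t) * W
      \<le> (1 + t)\<^sup>2 * (H / a) + 4 * (1 + 1 / t) * (2 + t) * \<delta>"
      by this (rule add_left_mono)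
  qed
  finally show ?thesis by (simp add: H_def)
qed

text \<open>The order of the limits matters: first \<delta> tends to 0 for fixed t, because its
  coefficient contains 1/t, and only then t tends to 0.\<close>

lemma transport_cost2_le_entropy:
  "transport_cost2 \<nu> \<mu> \<le> ennreal ((\<integral>x. ln (h x) \<partial>\<nu>) / a)"
proof -
  define K where "K = (\<integral>x. ln (h x) \<partial>\<nu>) / a"
  have step: "transport_cost2 \<nu> \<mu> \<le> ennreal ((1 + t)\<^sup>2 * K)" if t: "t > 0" for t
  proof (rule tendsto_lowerbound)
    have "((\<lambda>\<delta>. (1 + t)\<^sup>2 * K + 4 * (1 + 1 / t) * (2 + t) * \<delta>) \<longlongrightarrow> (1 + t)\<^sup>2 * K + 4 * (1 + 1 / t) * (2 + t) * 0) (at_right 0)"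
      by (intro tendsto_intros)
    then show "((\<lambda>\<delta>. ennreal ((1 + t)\<^sup>2 * K + 4 * (1 + 1 / t) * (2 + t) * \<delta>)) \<longlongrightarrow> ennreal ((1 + t)\<^sup>2 * K)) (at_right 0)"
      by (intro tendsto_ennrealI) simp
    show "\<forall>\<^sub>F \<delta> in at_right 0. transport_cost2 \<nu> \<mu> \<le> ennreal ((1 + t)\<^sup>2 * K + 4 * (1 + 1 / t) * (2 + t) * \<delta>)"
      using eventually_at_right_less[of 0]
      by eventually_elim (unfold K_def, rule transport_cost2_le_approx[OF t])
  qed simp
  have "transport_cost2 \<nu> \<mu> \<le> ennreal K"
  proof (rule tendsto_lowerbound)
    have "((\<lambda>t. (1 + t)\<^sup>2 * K) \<longlongrightarrow> (1 + 0)\<^sup>2 * K) (at_right 0)" by (intro tendsto_intros)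
    then show "((\<lambda>t. ennreal ((1 + t)\<^sup>2 * K)) \<longlongrightarrow> ennreal K) (at_right 0)"
      by (intro tendsto_ennrealI) simp
    show "\<forall>\<^sub>F t in at_right 0. transport_cost2 \<nu> \<mu> \<le> ennreal ((1 + t)\<^sup>2 * K)"
      using eventually_at_right_less[of 0] by eventually_elim (rule step)
  qed simp
  then show ?thesis by (simp add: K_def)
qed

end

theorem concentration_imp_T2:
  fixes \<mu> :: "'a::polish_space measure"
  assumes conc: "concentration \<mu> a r\<^sub>o b" and a: "a > 0" and P2: "P2 \<mu>"
  shows "T2 \<mu> (1 / a)"
  unfolding T2_def
proof (intro allI impI)
  fix \<nu> :: "'a measure" assume \<nu>: "prob_space \<nu> \<and> sets \<nu> = sets borel"
  obtain o\<^sub>x where \<mu>: "prob_space \<mu>" "sets \<mu> = sets borel"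
    and moment: "(\<integral>\<^sup>+ x. ennreal ((dist o\<^sub>x x)\<^sup>2) \<partial>\<mu>) < \<infinity>"
    using P2 by (auto simp: P2_def)
  interpret M: prob_space \<mu> by fact
  interpret N: prob_space \<nu> using \<nu> by simp
  define h where "h x = enn2real (RN_deriv \<mu> \<nu> x)" for x
  show "enn2ereal (transport_cost2 \<nu> \<mu>) \<le> ereal (1 / a) * rel_entropy \<nu> \<mu>"
  proof (cases "absolutely_continuous \<mu> \<nu> \<and> integrable \<nu> (\<lambda>x. ln (h x))")
    case True
    then have ac: "absolutely_continuous \<mu> \<nu>" and int: "integrable \<nu> (\<lambda>x. ln (h x))" by auto
    have sm: "sets \<nu> = sets \<mu>" using \<mu> \<nu> by simp
    have hm: "h \<in> borel_measurable \<mu>" by (simp add: h_def[abs_def])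
    \<comment> \<open>The derivative takes values in \<open>ennreal\<close>; being finite almost
      everywhere, it may be replaced by the real function \<open>h\<close> in the density.\<close>
    have "AE x in \<mu>. RN_deriv \<mu> \<nu> x \<noteq> \<infinity>"
      by (rule M.RN_deriv_finite[OF N.sigma_finite_measure_axioms ac sm])
    then have AE: "AE x in \<mu>. RN_deriv \<mu> \<nu> x = ennreal (h x)"
      by eventually_elim (simp add: h_def less_top)
    have "\<nu> = density \<mu> (RN_deriv \<mu> \<nu>)" by (rule M.density_RN_deriv[OF ac sm, symmetric])
    also have "\<dots> = density \<mu> h" by (rule density_cong[OF _ _ AE]) (use hm in auto)
    finally have d: "\<nu> = density \<mu> h" .
    have "0 \<le> (\<integral>x. ln (h x) \<partial>\<nu>)"
      by (rule entropy_nonneg[OF \<mu>(1) hm _ _ d int]) (use \<nu> in \<open>auto simp: h_def\<close>)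
    then have H0: "0 \<le> (\<integral>x. ln (h x) \<partial>\<nu>) / a" using a by simp
    have "transport_cost2 \<nu> \<mu> \<le> ennreal ((\<integral>x. ln (h x) \<partial>\<nu>) / a)"
      by (rule transport_cost2_le_entropy[OF conc a \<mu> hm _ _ d int moment])
        (use \<nu> in \<open>auto simp: h_def\<close>)
    then have "enn2ereal (transport_cost2 \<nu> \<mu>) \<le> ereal ((\<integral>x. ln (h x) \<partial>\<nu>) / a)"
      using H0 by (simp add: less_eq_ennreal.rep_eq)
    also have "\<dots> = ereal (1 / a) * rel_entropy \<nu> \<mu>"
      using True by (simp add: rel_entropy_def h_def)
    finally show ?thesis .
  next
    case False
    then have "rel_entropy \<nu> \<mu> = \<infinity>" by (auto simp: rel_entropy_def h_def)
    then show ?thesis using a by simp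
  qed
qed

theorem theorem3p1:
  fixes \<mu> :: "'a::polish_space measure" and a :: real
  assumes "P2 \<mu>" and "a > 0"
  shows "(\<exists>r\<^sub>o \<ge> 0. \<exists>b \<ge> 0. \<forall>n \<ge> 1. \<forall>A \<in> sets (prod_pow \<mu> n).
            measure (prod_pow \<mu> n) A \<ge> 1/2 \<longrightarrow>
            (\<forall>r \<ge> r\<^sub>o. outer_measure (prod_pow \<mu> n) (enlarge \<mu> n A r)
                        \<ge> 1 - b * exp (- a * (r - r\<^sub>o)\<^sup>2)))
     \<longleftrightarrow>
         (\<forall>\<nu>. prob_space \<nu> \<and> sets \<nu> = sets borel \<longrightarrow>
            enn2ereal (transport_cost2 \<nu> \<mu>) \<le> ereal (1 / a) * rel_entropy \<nu> \<mu>)"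
  unfolding T2_def[symmetric] concentration_def[symmetric]
proof
  assume "\<exists>r\<^sub>o\<ge>0. \<exists>b\<ge>0. concentration \<mu> a r\<^sub>o b"
  then show "T2 \<mu> (1 / a)" using concentration_imp_T2 assms by blast
next
  assume "T2 \<mu> (1 / a)"
  then have "concentration \<mu> a (sqrt (ln 2 / a)) 1"
    using assms by (intro T2_imp_concentration) (auto simp: P2_def)
  then show "\<exists>r\<^sub>o\<ge>0. \<exists>b\<ge>0. concentration \<mu> a r\<^sub>o b"
    using assms by (intro exI[of _ "sqrt (ln 2 / a)"] conjI exI[of _ 1]) auto
qed

end
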